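(* For each $n\geq 1$ let $K_n$ be a set of set functions over $n$ variables with $\mathrm{Mod}_n\subseteq K_n\subseteq\Gamma_n$. Then the following decision problem (the information inequality problem over $K$ with respect to acyclic $\Sigma$-inequalities) is solvable in polynomial time: given an acyclic $\Sigma$-inequality $$\sum_{\sigma\in\Sigma}w_\sigma h(\sigma)\geq h(\mathbf{X})$$ over a set $\mathbf{X}$ of $n$ variables, decide whether it is valid over $K_n$.
   Context: A set function over a finite variable set $\mathbf{X}$ with $|\mathbf{X}|=n$ is a function $h:2^{\mathbf{X}}\to\mathbb{R}$ with $h(\emptyset)=0$. A polymatroid is a set function $h$ satisfying $h(\emptyset)=0$, monotonicity $h(\mathbf{Y}\cup\mathbf{Z})\geq h(\mathbf{Y})$, and submodularity $h(\mathbf{Y})+h(\mathbf{Z})\geq h(\mathbf{Y}\cap\mathbf{Z})+h(\mathbf{Y}\cup\mathbf{Z})$ for all $\mathbf{Y},\mathbf{Z}\subseteq\mathbf{X}$; $\Gamma_n$ is the set of polymatroids over $n$ variables. A polymatroid is modular if submodularity always holds with equality; $\mathrm{Mod}_n$ is the set of modular polymatroids over $n$ variables. A conditional over $\mathbf{X}$ is an expression $\sigma=(\mathbf{V}\mid\mathbf{U})$ with $\mathbf{U},\mathbf{V}\subseteq\mathbf{X}$, and $h(\sigma)=h(\mathbf{V}\mid\mathbf{U}):=h(\mathbf{U}\cup\mathbf{V})-h(\mathbf{U})$. A $\Sigma$-inequality is an inequality $\sum_{\sigma\in\Sigma}w_\sigma h(\sigma)\geq h(\mathbf{X})$, where $\Sigma$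 is a finite set of conditionals over $\mathbf{X}$ and $w_\sigma\geq 0$ for $\sigma\in\Sigma$. It is acyclic if the following directed graph is acyclic: the vertices are the variables in $\mathbf{X}$, and there is an edge from $A$ to $B$ if $A\in\mathbf{U}$ and $B\in\mathbf{V}\setminus\mathbf{U}$ for some $(\mathbf{V}\mid\mathbf{U})\in\Sigma$. An inequality is valid over a set of set functions if it holds for all $h$ in the set. As inputs, the coefficients are rational and encoded in binary, and the inequality is encoded as the explicit list of its coefficients and variable sets (so not as a vector of length $2^n$). *)

theory Defs
  imports Complex_Main "HOL-Library.FuncSet" "HOL-Computational_Algebra.Polynomial"
begin

section \<open>Set functions, polymatroids and \<open>\<Sigma>\<close>-inequalities\<close>

text \<open>Functions on the power set of \<open>X\<close> are extensional, so that two set functions over \<open>X\<close>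
  that agree on all subsets of \<open>X\<close> are the same object, and sets of set functions may be
  compared by inclusion.\<close>

definition set_functions :: "'a set \<Rightarrow> ('a set \<Rightarrow> real) set" where
  "set_functions X = {h \<in> Pow X \<rightarrow>\<^sub>E UNIV. h {} = 0}"

definition polymatroids :: "'a set \<Rightarrow> ('a set \<Rightarrow> real) set" where
  "polymatroids X = {h \<in> set_functions X.
     (\<forall>Y Z. Y \<subseteq> X \<longrightarrow> Z \<subseteq> X \<longrightarrow> h (Y \<union> Z) \<ge> h Y) \<and>
     (\<forall>Y Z. Y \<subseteq> X \<longrightarrow> Z \<subseteq> X \<longrightarrow> h Y + h Z \<ge> h (Y \<inter> Z) + h (Y \<union> Z))}"

definition modular_polymatroids :: "'a set \<Rightarrow> ('a set \<Rightarrow> real) set" where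
  "modular_polymatroids X = {h \<in> polymatroids X.
     \<forall>Y Z. Y \<subseteq> X \<longrightarrow> Z \<subseteq> X \<longrightarrow> h Y + h Z = h (Y \<inter> Z) + h (Y \<union> Z)}"

text \<open>The pair \<open>(V, U)\<close> stands for the conditional \<open>(V | U)\<close>.\<close>

type_synonym 'a conditional = "'a set \<times> 'a set"

definition cond_value :: "('a set \<Rightarrow> real) \<Rightarrow> 'a conditional \<Rightarrow> real" where
  "cond_value h = (\<lambda>(V, U). h (U \<union> V) - h U)"

definition sigma_inequality :: "'a set \<Rightarrow> 'a conditional set \<Rightarrow> ('a conditional \<Rightarrow> real) \<Rightarrow> bool" where
  "sigma_inequality X \<Sigma> w \<longleftrightarrow>
     finite \<Sigma> \<and> (\<forall>(V, U) \<in> \<Sigma>. V \<subseteq> X \<and> U \<subseteq> X) \<and> (\<forall>\<sigma> \<in> \<Sigma>. w \<sigma> \<ge> 0)"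

definition cond_graph :: "'a conditional set \<Rightarrow> ('a \<times> 'a) set" where
  "cond_graph \<Sigma> = {(A, B). \<exists>(V, U) \<in> \<Sigma>. A \<in> U \<and> B \<in> V - U}"

definition acyclic_sigma_inequality ::
    "'a set \<Rightarrow> 'a conditional set \<Rightarrow> ('a conditional \<Rightarrow> real) \<Rightarrow> bool" where
  "acyclic_sigma_inequality X \<Sigma> w \<longleftrightarrow> sigma_inequality X \<Sigma> w \<and> acyclic (cond_graph \<Sigma>)"

definition valid_over ::
    "('a set \<Rightarrow> real) set \<Rightarrow> 'a set \<Rightarrow> 'a conditional set \<Rightarrow> ('a conditional \<Rightarrow> real) \<Rightarrow> bool" where
  "valid_over K X \<Sigma> w \<longleftrightarrow> (\<forall>h \<in> K. (\<Sum>\<sigma>\<in>\<Sigma>. w \<sigma> * cond_value h \<sigma>) \<ge> h X)"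


section \<open>Deterministic multi-tape Turing machines and polynomial time\<close>

text \<open>States and tape symbols are initial segments of the natural numbers; symbol \<open>0\<close> is the
  blank. A tape is two-way infinite and is given by its contents and its head position.\<close>

datatype move = Move_Left | Stay | Move_Right

record turing_machine =
  num_tapes :: nat
  num_states :: nat
  num_symbols :: nat
  start_state :: nat
  accept_state :: nat
  reject_state :: nat
  delta :: "nat \<Rightarrow> nat list \<Rightarrow> nat \<times> (nat \<times> move) list"

definition wf_machine :: "turing_machine \<Rightarrow> bool" where
  "wf_machine M \<longleftrightarrow>
     num_tapes M \<ge> 1 \<and> num_symbols M \<ge> 1 \<and>
     start_state M < num_states M \<and> accept_state M < num_states M \<and>
     reject_state M < num_states M \<and> accept_state M \<noteq> reject_state M \<and>
     (\<forall>q ss. q < num_states M \<longrightarrow> length ss = num_tapes M \<longrightarrow> set ss \<subseteq> {..<num_symbols M} \<longrightarrow>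
        (case delta M q ss of (q', acts) \<Rightarrow>
           q' < num_states M \<and> length acts = num_tapes M \<and> fst ` set acts \<subseteq> {..<num_symbols M}))"

type_synonym tape = "(int \<Rightarrow> nat) \<times> int"
type_synonym config = "nat \<times> tape list"

fun head_symbol :: "tape \<Rightarrow> nat" where
  "head_symbol (f, p) = f p"

fun head_shift :: "move \<Rightarrow> int" where
  "head_shift Move_Left = - 1"
| "head_shift Stay = 0"
| "head_shift Move_Right = 1"

fun act_on_tape :: "nat \<times> move \<Rightarrow> tape \<Rightarrow> tape" where
  "act_on_tape (s, d) (f, p) = (f(p := s), p + head_shift d)"

fun step :: "turing_machine \<Rightarrow> config \<Rightarrow> config" where
  "step M (q, ts) =
     (if q = accept_state M \<or> q = reject_state M then (q, ts)
      else case delta M q (map head_symbol ts) of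
        (q', acts) \<Rightarrow> (q', map2 act_on_tape acts ts))"

definition input_tape :: "nat list \<Rightarrow> tape" where
  "input_tape xs = (\<lambda>i. if 0 \<le> i \<and> i < int (length xs) then xs ! nat i else 0, 0)"

definition initial_config :: "turing_machine \<Rightarrow> nat list \<Rightarrow> config" where
  "initial_config M xs =
     (start_state M, input_tape xs # replicate (num_tapes M - 1) (input_tape []))"

text \<open>Since the two halting states are distinct and never left, the answer is unique.\<close>

definition answers_within :: "turing_machine \<Rightarrow> nat list \<Rightarrow> bool \<Rightarrow> nat \<Rightarrow> bool" where
  "answers_within M xs b t \<longleftrightarrow>
     fst ((step M ^^ t) (initial_config M xs)) = (if b then accept_state M else reject_state M)"

text \<open>A decision problem is given by its set \<open>I\<close> of instances, an encoding of instances as words,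
  and the set of yes-instances, as a predicate on \<open>I\<close>. The running time is measured in the
  length of the encoding.\<close>

definition polynomial_time_decidable :: "('i \<Rightarrow> nat list) \<Rightarrow> 'i set \<Rightarrow> ('i \<Rightarrow> bool) \<Rightarrow> bool" where
  "polynomial_time_decidable enc I P \<longleftrightarrow>
     (\<exists>M. \<exists>p :: nat poly. wf_machine M \<and>
        (\<forall>i \<in> I. set (enc i) \<subseteq> {1..<num_symbols M} \<and>
           answers_within M (enc i) (P i) (poly p (length (enc i)))))"


section \<open>Encoding of \<open>\<Sigma>\<close>-inequalities with rational coefficients\<close>

datatype letter = Zero | One | Slash | Comma | Bar | Open_Paren | Close_Paren | Leq

fun letter_code :: "letter \<Rightarrow> nat" where
  "letter_code Zero = 1"
| "letter_code One = 2"
| "letter_code Slash = 3"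
| "letter_code Comma = 4"
| "letter_code Bar = 5"
| "letter_code Open_Paren = 6"
| "letter_code Close_Paren = 7"
| "letter_code Leq = 8"

text \<open>Most significant digit first; \<open>0\<close> is written as the single digit \<open>Zero\<close>.\<close>

fun binary :: "nat \<Rightarrow> letter list" where
  "binary k = (if k < 2 then [] else binary (k div 2)) @ [if odd k then One else Zero]"

declare binary.simps [simp del]

text \<open>Numerator and denominator in lowest terms; only used for nonnegative numbers.\<close>

definition encode_rat :: "rat \<Rightarrow> letter list" where
  "encode_rat r = (case quotient_of r of (a, b) \<Rightarrow> binary (nat a) @ [Slash] @ binary (nat b))"

definition encode_set :: "nat set \<Rightarrow> letter list" where
  "encode_set V = concat (map (\<lambda>x. binary x @ [Comma]) (sorted_list_of_set V))"

definition encode_term :: "rat \<Rightarrow> nat conditional \<Rightarrow> letter list" where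
  "encode_term r = (\<lambda>(V, U).
     encode_rat r @ [Open_Paren] @ encode_set V @ [Bar] @ encode_set U @ [Close_Paren])"

text \<open>An instance \<open>(n, \<sigma>s, w)\<close> is the inequality over the variables \<open>{..<n}\<close> whose set of
  conditionals is listed, without repetition and in arbitrary order, by \<open>\<sigma>s\<close>. It is written as
  the variable set on the smaller side, followed by the terms of the sum on the larger side.\<close>

type_synonym sigma_instance = "nat \<times> nat conditional list \<times> (nat conditional \<Rightarrow> rat)"

definition encode_instance :: "sigma_instance \<Rightarrow> nat list" where
  "encode_instance = (\<lambda>(n, \<sigma>s, w). map letter_code
     (encode_set {..<n} @ [Leq] @ concat (map (\<lambda>\<sigma>. encode_term (w \<sigma>) \<sigma>) \<sigma>s)))"

definition acyclic_instances :: "sigma_instance set" where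
  "acyclic_instances = {(n, \<sigma>s, w). n \<ge> 1 \<and> distinct \<sigma>s \<and>
     acyclic_sigma_inequality {..<n} (set \<sigma>s) (\<lambda>\<sigma>. of_rat (w \<sigma>))}"

definition valid_instance :: "(nat \<Rightarrow> (nat set \<Rightarrow> real) set) \<Rightarrow> sigma_instance \<Rightarrow> bool" where
  "valid_instance K = (\<lambda>(n, \<sigma>s, w). valid_over (K n) {..<n} (set \<sigma>s) (\<lambda>\<sigma>. of_rat (w \<sigma>)))"

end

theory Submission
  imports Defs
begin

text \<open>For an acyclic \<open>\<Sigma>\<close>-inequality, validity over the modular polymatroids and over all polymatroids
  are both equivalent to the condition that each variable \<open>x\<close> is covered, i.e. that the weights of
  the conditionals \<open>(V | U)\<close> with \<open>x \<in> V - U\<close> sum up to at least 1. Necessity follows by testing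
  the modular function \<open>h Y = (if x \<in> Y then 1 else 0)\<close>, sufficiency by the chain rule along a
  topological order of the variables.

  A Turing machine decides the covering condition variable by variable, keeping the sum of weights
  as a fraction \<open>A/B\<close> of binary numbers; a weight \<open>a/b\<close> turns it into \<open>(a B + b A)/(b B)\<close>. No
  fraction is ever reduced, but the lengths of \<open>A\<close> and \<open>B\<close> grow only by a constant times
  the length of the term read. The machine is the compilation of a structured program whose variables
  are stacks, one per tape. A run in which all stacks have length at most \<open>N\<close> takes time
  polynomial in \<open>N\<close>, because each loop shortens its controlling stack.\<close>

section \<open>The covering criterion\<close>

text \<open>In general a polymatroid has exponentially many independent values, and testing an
  inequality on all of them is a linear program of that size. Acyclicity removes this obstacle: one
  order of the variables serves all conditionals at once, so a single chain of prefixes bounds every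
  h(V | U) from below, and n sums remain to be tested.

  The arithmetic is shaped by what stacks can do. Reducing a fraction would need division, whereas
  the unreduced update needs only doubling and addition. In the encoding the weight precedes its
  conditional, so the new fraction is computed before it is known whether the term counts; old and
  new fraction coexist until V and U have been read.\<close>

lemma valid_over_mono: "valid_over L X \<Sigma> w \<Longrightarrow> K \<subseteq> L \<Longrightarrow> valid_over K X \<Sigma> w"
  unfolding valid_over_def by blast

lemma valid_over_modular_imp_cover:
  assumes val: "valid_over (modular_polymatroids X) X \<Sigma> w" and sig: "sigma_inequality X \<Sigma> w"
    and x: "x \<in> X"
  shows "1 \<le> (\<Sum>\<sigma> | \<sigma> \<in> \<Sigma> \<and> x \<in> fst \<sigma> - snd \<sigma>. w \<sigma>)"
proof -
  define h :: "'a set \<Rightarrow> real" where "h = restrict (\<lambda>Y. if x \<in> Y then 1 else 0) (Pow X)"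
  have h: "h Y = (if x \<in> Y then 1 else 0)" if "Y \<subseteq> X" for Y
    using that by (simp add: h_def)
  have "h \<in> set_functions X"
    by (auto simp: set_functions_def h_def)
  then have "h \<in> polymatroids X"
    by (auto simp: polymatroids_def h le_infI1)
  then have hm: "h \<in> modular_polymatroids X"
    by (auto simp: modular_polymatroids_def h le_infI1)
  have fin: "finite \<Sigma>" and sub: "\<And>V U. (V, U) \<in> \<Sigma> \<Longrightarrow> V \<subseteq> X \<and> U \<subseteq> X"
    using sig by (auto simp: sigma_inequality_def)
  have "1 = h X" using x by (simp add: h)
  also have "\<dots> \<le> (\<Sum>\<sigma>\<in>\<Sigma>. w \<sigma> * cond_value h \<sigma>)"
    using val hm by (auto simp: valid_over_def)
  \<comment> \<open>The indicator of membership of x increases from U to U \<union> V exactly when x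
    lies in V - U.\<close>
  also have "\<dots> = (\<Sum>\<sigma>\<in>\<Sigma>. if x \<in> fst \<sigma> - snd \<sigma> then w \<sigma> else 0)"
    by (intro sum.cong refl) (auto simp: cond_value_def h dest!: sub)
  also have "\<dots> = (\<Sum>\<sigma> | \<sigma> \<in> \<Sigma> \<and> x \<in> fst \<sigma> - snd \<sigma>. w \<sigma>)"
    using fin by (subst sum.inter_filter) auto
  finally show ?thesis .
qed

text \<open>A finite acyclic relation is well-founded, so the remaining variables always contain one
  without incoming edge from the others; it is put in front. No edge then leads from a later element
  to an earlier one.\<close>

lemma finite_acyclic_topological_list:
  assumes "acyclic r" "finite Y"
  shows "\<exists>xs. set xs = Y \<and> distinct xs \<and> sorted_wrt (\<lambda>a b. (b, a) \<notin> r) xs"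
  using assms(2)
proof (induction Y rule: finite_psubset_induct)
  case (psubset Y)
  show ?case
  proof (cases "Y = {}")
    case False
    \<comment> \<open>The relation itself may be infinite, hence the restriction to
      \<open>Y\<close>.\<close>
    have "finite (r \<inter> Y \<times> Y)" using psubset.hyps by auto
    moreover have "acyclic (r \<inter> Y \<times> Y)" using assms(1) by (rule acyclic_subset) auto
    ultimately have "wf (r \<inter> Y \<times> Y)" by (rule finite_acyclic_wf)
    moreover obtain y where "y \<in> Y" using False by blast
    ultimately obtain z where "z \<in> Y" "\<And>y. (y, z) \<in> r \<inter> Y \<times> Y \<Longrightarrow> y \<notin> Y"
      by (rule wfE_min) blast
    then have z: "z \<in> Y" "\<forall>y\<in>Y. (y, z) \<notin> r" by blast+
    obtain xs where "set xs = Y - {z}" "distinct xs" "sorted_wrt (\<lambda>a b. (b, a) \<notin> r) xs"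
      using psubset.IH[of "Y - {z}"] z(1) by blast
    with z have "set (z # xs) = Y" "distinct (z # xs)" "sorted_wrt (\<lambda>a b. (b, a) \<notin> r) (z # xs)"
      by auto
    then show ?thesis by (intro exI[of _ "z # xs"]) auto
  qed auto
qed

text \<open>Along a topological order, all of \<open>U\<close> precedes each element of \<open>V - U\<close>, so submodularity
  bounds the increments of \<open>h(V | U)\<close> from below by those of the chain of all prefixes.\<close>

lemma cover_imp_valid_over_polymatroids:
  assumes fin: "finite X" and acyc: "acyclic_sigma_inequality X \<Sigma> w"
    and cover: "\<And>x. x \<in> X \<Longrightarrow> 1 \<le> (\<Sum>\<sigma> | \<sigma> \<in> \<Sigma> \<and> x \<in> fst \<sigma> - snd \<sigma>. w \<sigma>)"
  shows "valid_over (polymatroids X) X \<Sigma> w"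
  unfolding valid_over_def
proof
  fix h assume h: "h \<in> polymatroids X"
  have h0: "h {} = 0" and mono: "\<And>Y Z. Y \<subseteq> X \<Longrightarrow> Z \<subseteq> X \<Longrightarrow> h Y \<le> h (Y \<union> Z)"
    and subm: "\<And>Y Z. Y \<subseteq> X \<Longrightarrow> Z \<subseteq> X \<Longrightarrow> h (Y \<inter> Z) + h (Y \<union> Z) \<le> h Y + h Z"
    using h by (auto simp: polymatroids_def set_functions_def)
  have fS: "finite \<Sigma>" and sub: "\<And>V U. (V, U) \<in> \<Sigma> \<Longrightarrow> V \<subseteq> X \<and> U \<subseteq> X"
    and w: "\<And>\<sigma>. \<sigma> \<in> \<Sigma> \<Longrightarrow> 0 \<le> w \<sigma>" and acy: "acyclic (cond_graph \<Sigma>)"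
    using acyc by (auto simp: acyclic_sigma_inequality_def sigma_inequality_def)
  obtain xs where xs: "set xs = X" "distinct xs"
      and srt: "sorted_wrt (\<lambda>a b. (b, a) \<notin> cond_graph \<Sigma>) xs"
    using finite_acyclic_topological_list[OF acy fin] by blast
  define P where "P k = set (take k xs)" for k
  define a where "a i = h (P (Suc i)) - h (P i)" for i
  have PX: "P k \<subseteq> X" for k using set_take_subset[of k xs] xs(1) by (simp add: P_def)
  have PSuc: "P (Suc k) = insert (xs ! k) (P k)" if "k < length xs" for k
    using that by (simp add: P_def take_Suc_conv_app_nth)
  have notP: "xs ! k \<notin> P k" if "k < length xs" for k
    using that xs(2) by (auto simp: P_def in_set_conv_nth nth_eq_iff_index_eq)
  have a0: "0 \<le> a i" if "i < length xs" for i
    using mono[OF PX PX, of i "Suc i"] PSuc[OF that] by (simp add: a_def insert_absorb Un_absorb1)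
  have tel: "(\<Sum>i<k. a i) = h (P k)" for k
    using sum_lessThan_telescope[of "\<lambda>k. h (P k)" k] by (simp add: a_def P_def h0)
  have chain: "(\<Sum>i<k. if xs ! i \<in> V - U then a i else 0) \<le> h (U \<union> (V \<inter> P k)) - h U"
    if VU: "(V, U) \<in> \<Sigma>" and k: "k \<le> length xs" for V U k
    using k
  proof (induction k)
    case 0
    then show ?case by (simp add: P_def)
  next
    case (Suc k)
    then have k: "k < length xs" by simp
    show ?case
    proof (cases "xs ! k \<in> V - U")
      case True
      have UP: "U \<subseteq> P k"
      proof
        fix u assume u: "u \<in> U"
        then obtain j where j: "j < length xs" "xs ! j = u"
          using sub[OF VU] xs(1) by (metis in_mono in_set_conv_nth)
        have e: "(u, xs ! k) \<in> cond_graph \<Sigma>"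
          using u True VU by (auto simp: cond_graph_def)
        have "\<not> k < j"
          using srt j e by (auto simp: sorted_wrt_iff_nth_less)
        moreover have "j \<noteq> k" using True u j by auto
        ultimately show "u \<in> P k"
          using j k by (auto simp: P_def in_set_conv_nth intro!: exI[of _ j])
      qed
      let ?Y = "U \<union> (V \<inter> P k)"
      \<comment> \<open>Submodularity for the enlarged set and the prefix: they meet in
        \<open>?Y\<close> and unite to the next prefix, so adding \<open>xs ! k\<close> to the
        smaller set \<open>?Y\<close> gains at least \<open>a k\<close>.\<close>
      have "h (insert (xs ! k) ?Y \<inter> P k) + h (insert (xs ! k) ?Y \<union> P k) \<le> h (insert (xs ! k) ?Y) + h (P k)"
        using sub[OF VU] PX xs(1) k by (intro subm) auto
      moreover have "insert (xs ! k) ?Y \<inter> P k = ?Y" using notP[OF k] UP by auto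
      moreover have "insert (xs ! k) ?Y \<union> P k = P (Suc k)" using PSuc[OF k] UP by auto
      moreover have "insert (xs ! k) ?Y = U \<union> (V \<inter> P (Suc k))" using PSuc[OF k] True by auto
      ultimately show ?thesis using Suc True by (simp add: a_def)
    next
      \<comment> \<open>Either the variable is outside V or it already lies in U; in both cases
        neither side of the bound changes.\<close>
      case False
      then have "U \<union> (V \<inter> P (Suc k)) = U \<union> (V \<inter> P k)" using PSuc[OF k] by auto
      then show ?thesis using Suc False by auto
    qed
  qed
  let ?n = "length xs"
  have PN: "P ?n = X" using xs by (simp add: P_def)
  have "h X = (\<Sum>i<?n. a i)" by (simp add: tel PN)
  \<comment> \<open>Monotonicity enters here: the increments are nonnegative, so factors of at least
    1 can only enlarge them. Exchanging the sums then collects the increments by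
    conditional.\<close>
  also have "\<dots> \<le> (\<Sum>i<?n. a i * (\<Sum>\<sigma> | \<sigma> \<in> \<Sigma> \<and> xs ! i \<in> fst \<sigma> - snd \<sigma>. w \<sigma>))"
  proof (rule sum_mono)
    fix i assume "i \<in> {..<?n}"
    then have "0 \<le> a i" "xs ! i \<in> X" using a0 xs(1) by auto
    then show "a i \<le> a i * (\<Sum>\<sigma> | \<sigma> \<in> \<Sigma> \<and> xs ! i \<in> fst \<sigma> - snd \<sigma>. w \<sigma>)"
      using mult_left_mono[OF cover, of "xs ! i" "a i"] by simp
  qed
  also have "\<dots> = (\<Sum>i<?n. \<Sum>\<sigma>\<in>\<Sigma>. w \<sigma> * (if xs ! i \<in> fst \<sigma> - snd \<sigma> then a i else 0))"
    using fS by (intro sum.cong refl)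
      (simp add: sum_distrib_left sum.inter_filter if_distrib mult.commute cong: if_cong)
  also have "\<dots> = (\<Sum>\<sigma>\<in>\<Sigma>. w \<sigma> * (\<Sum>i<?n. if xs ! i \<in> fst \<sigma> - snd \<sigma> then a i else 0))"
    by (subst sum.swap) (simp add: sum_distrib_left)
  also have "\<dots> \<le> (\<Sum>\<sigma>\<in>\<Sigma>. w \<sigma> * cond_value h \<sigma>)"
  proof (intro sum_mono mult_left_mono w)
    fix \<sigma> assume s: "\<sigma> \<in> \<Sigma>"
    obtain V U where VU: "\<sigma> = (V, U)" by fastforce
    then show "(\<Sum>i<?n. if xs ! i \<in> fst \<sigma> - snd \<sigma> then a i else 0) \<le> cond_value h \<sigma>"
      using chain[of V U ?n] s sub[of V U] by (simp add: cond_value_def PN Int_absorb2)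
  qed
  finally show "h X \<le> (\<Sum>\<sigma>\<in>\<Sigma>. w \<sigma> * cond_value h \<sigma>)" .
qed

lemma valid_over_iff_cover:
  assumes "finite X" "acyclic_sigma_inequality X \<Sigma> w"
    and "modular_polymatroids X \<subseteq> K" "K \<subseteq> polymatroids X"
  shows "valid_over K X \<Sigma> w \<longleftrightarrow> (\<forall>x\<in>X. 1 \<le> (\<Sum>\<sigma> | \<sigma> \<in> \<Sigma> \<and> x \<in> fst \<sigma> - snd \<sigma>. w \<sigma>))"
proof
  assume "valid_over K X \<Sigma> w"
  then have "valid_over (modular_polymatroids X) X \<Sigma> w" using assms(3) by (rule valid_over_mono)
  then show "\<forall>x\<in>X. 1 \<le> (\<Sum>\<sigma> | \<sigma> \<in> \<Sigma> \<and> x \<in> fst \<sigma> - snd \<sigma>. w \<sigma>)"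
    using assms(2) valid_over_modular_imp_cover[of X \<Sigma> w] by (simp add: acyclic_sigma_inequality_def)
next
  assume "\<forall>x\<in>X. 1 \<le> (\<Sum>\<sigma> | \<sigma> \<in> \<Sigma> \<and> x \<in> fst \<sigma> - snd \<sigma>. w \<sigma>)"
  then have "valid_over (polymatroids X) X \<Sigma> w"
    using assms(1,2) by (intro cover_imp_valid_over_polymatroids) auto
  then show "valid_over K X \<Sigma> w" using assms(4) by (rule valid_over_mono)
qed

section \<open>Stack programs and their Turing machines\<close>

text \<open>\<open>Put\<close> occurs in control states only: it is the second half of \<open>Push\<close>, which has to move the
  head before it can write.\<close>

datatype com =
    Skip
  | Push nat nat
  | Put nat nat
  | Pop nat
  | Seq com com  (infixr ";;" 60)
  | Case nat "nat \<Rightarrow> com"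
  | While nat "nat \<Rightarrow> bool" com

type_synonym stacks = "nat \<Rightarrow> nat list"

text \<open>An empty stack shows the blank, as the head does on the tape. Emptiness is therefore
  tested by comparison with 0, provided that 0 is never stored.\<close>

definition top0 :: "nat list \<Rightarrow> nat" where
  "top0 xs = (case xs of [] \<Rightarrow> 0 | a # _ \<Rightarrow> a)"

lemma top0_simps [simp]: "top0 [] = 0" "top0 (a # xs) = a"
  by (simp_all add: top0_def)

text \<open>The two side conditions carry the complexity analysis: \<open>Push\<close> respects the
  height bound \<open>N\<close>, and each round of a loop has to shorten the controlling stack,
  which limits the number of rounds by \<open>N\<close>.\<close>

inductive exec :: "nat \<Rightarrow> com \<Rightarrow> stacks \<Rightarrow> stacks \<Rightarrow> bool" for N where
  Skip: "exec N Skip s s"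
| Push: "length (s k) < N \<Longrightarrow> exec N (Push k a) s (s(k := a # s k))"
| Pop: "exec N (Pop k) s (s(k := tl (s k)))"
| Seq: "exec N c s s' \<Longrightarrow> exec N d s' s'' \<Longrightarrow> exec N (c ;; d) s s''"
| Case: "exec N (f (top0 (s k))) s s' \<Longrightarrow> exec N (Case k f) s s'"
| While_False: "\<not> P (top0 (s k)) \<Longrightarrow> exec N (While k P c) s s"
| While_True: "P (top0 (s k)) \<Longrightarrow> exec N c s s' \<Longrightarrow> length (s' k) < length (s k) \<Longrightarrow>
    exec N (While k P c) s' s'' \<Longrightarrow> exec N (While k P c) s s''"

inductive_cases exec_SkipE: "exec N Skip s s'"
  and exec_PushE: "exec N (Push k a) s s'"
  and exec_PutE: "exec N (Put k a) s s'"
  and exec_PopE: "exec N (Pop k) s s'"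
  and exec_SeqE: "exec N (c ;; d) s s'"
  and exec_CaseE: "exec N (Case k f) s s'"
  and exec_WhileE: "exec N (While k P c) s s'"

primrec wf_com :: "nat \<Rightarrow> nat \<Rightarrow> com \<Rightarrow> bool" where
  "wf_com l m Skip \<longleftrightarrow> True"
| "wf_com l m (Push k a) \<longleftrightarrow> k < l \<and> a < m"
| "wf_com l m (Put k a) \<longleftrightarrow> k < l \<and> a < m"
| "wf_com l m (Pop k) \<longleftrightarrow> k < l"
| "wf_com l m (c ;; d) \<longleftrightarrow> wf_com l m c \<and> wf_com l m d"
| "wf_com l m (Case k f) \<longleftrightarrow> k < l \<and> (\<forall>a<m. wf_com l m (f a))"
| "wf_com l m (While k P c) \<longleftrightarrow> k < l \<and> wf_com l m c"

text \<open>A bound in terms of the height \<open>N\<close>: a push takes two machine steps,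
  unfolding a sequence takes one, and a loop has at most \<open>N\<close> rounds plus the failing
  test. The branches of a case distinction are summed because a maximum of polynomials need not be a
  polynomial.\<close>

primrec time_poly :: "nat \<Rightarrow> com \<Rightarrow> nat poly" where
  "time_poly m Skip = [:1:]"
| "time_poly m (Push k a) = [:2:]"
| "time_poly m (Put k a) = 0"
| "time_poly m (Pop k) = [:1:]"
| "time_poly m (c ;; d) = [:1:] + time_poly m c + time_poly m d"
| "time_poly m (Case k f) = [:1:] + (\<Sum>a<m. time_poly m (f a))"
| "time_poly m (While k P c) = [:1:] + [:0, 1:] * ([:1:] + time_poly m c)"

text \<open>The control state of the machine is the list of commands still to be executed.\<close>

fun control_step :: "com list \<Rightarrow> nat list \<Rightarrow> com list \<times> (nat \<times> move) list" where
  "control_step [] ss = ([], map (\<lambda>a. (a, Stay)) ss)"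
| "control_step (Skip # K) ss = (K, map (\<lambda>a. (a, Stay)) ss)"
| "control_step (Push k a # K) ss = (Put k a # K, (map (\<lambda>a. (a, Stay)) ss)[k := (ss ! k, Move_Left)])"
| "control_step (Put k a # K) ss = (K, (map (\<lambda>a. (a, Stay)) ss)[k := (a, Stay)])"
| "control_step (Pop k # K) ss = (K, (map (\<lambda>a. (a, Stay)) ss)[k := (ss ! k, Move_Right)])"
| "control_step ((c ;; d) # K) ss = (c # d # K, map (\<lambda>a. (a, Stay)) ss)"
| "control_step (Case k f # K) ss = (f (ss ! k) # K, map (\<lambda>a. (a, Stay)) ss)"
| "control_step (While k P c # K) ss =
     (if P (ss ! k) then c # While k P c # K else K, map (\<lambda>a. (a, Stay)) ss)"

text \<open>\<open>Case\<close> branches over all natural numbers, so finiteness of the control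
  rests on the restriction to symbols below \<open>m\<close>. A loop is the continuation of its own
  body, hence iteration creates no new states. The continuation \<open>K\<close> itself is not
  included.\<close>

primrec reachable :: "nat \<Rightarrow> com \<Rightarrow> com list \<Rightarrow> com list set" where
  "reachable m Skip K = {Skip # K}"
| "reachable m (Push k a) K = {Push k a # K, Put k a # K}"
| "reachable m (Put k a) K = {Put k a # K}"
| "reachable m (Pop k) K = {Pop k # K}"
| "reachable m (c ;; d) K = insert ((c ;; d) # K) (reachable m c (d # K) \<union> reachable m d K)"
| "reachable m (Case k f) K = insert (Case k f # K) (\<Union>a<m. reachable m (f a) K)"
| "reachable m (While k P c) K = insert (While k P c # K) (reachable m c (While k P c # K))"

lemma finite_reachable: "finite (reachable m c K)"
  by (induction c arbitrary: K) auto

lemma Cons_in_reachable: "c # K \<in> reachable m c K"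
  by (induction c arbitrary: K) auto

lemma control_step_in_reachable:
  assumes "wf_com l m c" "q \<in> reachable m c K" "length ss = l" "set ss \<subseteq> {..<m}"
  shows "fst (control_step q ss) \<in> insert K (reachable m c K) \<and> length (snd (control_step q ss)) = l \<and>
    fst ` set (snd (control_step q ss)) \<subseteq> {..<m}"
proof -
  have upd: "fst ` set ((map (\<lambda>a. (a, d)) ss)[k := (a, d')]) \<subseteq> {..<m}" if "a < m" for k a d d'
    using assms(4) that set_update_subset_insert[of "map (\<lambda>a. (a, d)) ss" k "(a, d')"] by fastforce
  have nth: "ss ! k < m" if "k < l" for k
    using that assms(3,4) nth_mem by blast
  show ?thesis
    using assms(1,2)
  proof (induction c arbitrary: K)
    case (Seq c d)
    from Seq.prems consider "q = (c ;; d) # K" | "q \<in> reachable m c (d # K)" | "q \<in> reachable m d K" by auto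
    then show ?case
      using Seq.IH(1)[of "d # K"] Seq.IH(2)[of K] Seq.prems(1) Cons_in_reachable assms(3,4)
      by cases (auto simp: image_image)
  next
    case (Case k f)
    from Case.prems consider "q = Case k f # K" | a where "a < m" "q \<in> reachable m (f a) K" by auto
    then show ?case
    proof cases
      case 1
      then have "f (ss ! k) # K \<in> (\<Union>a<m. reachable m (f a) K)"
        using Case.prems(1) nth Cons_in_reachable by (intro UN_I[of "ss ! k"]) auto
      then show ?thesis using 1 assms(3,4) by (auto simp: image_image)
    next
      case (2 a)
      then show ?thesis using Case.IH[of "f a" K] Case.prems by auto
    qed
  next
    case (While k P c)
    from While.prems consider "q = While k P c # K" | "q \<in> reachable m c (While k P c # K)" by auto
    then show ?case
      using While.IH[of "While k P c # K"] While.prems(1) Cons_in_reachable assms(3,4)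
      by cases (auto simp: image_image)
  next
    case Skip
    then show ?case using assms(3,4) by (auto simp: image_image)
  next
    case (Push k a)
    then consider "q = Push k a # K" | "q = Put k a # K" by auto
    then show ?case using upd[OF nth, of k Stay k Move_Left] upd[of a Stay k Stay] Push assms(3) by cases auto
  next
    case (Put k a)
    then show ?case using upd[of a Stay k Stay] assms(3) by auto
  next
    case (Pop k)
    then show ?case using upd[OF nth, of k Stay k Move_Right] assms(3) by auto
  qed
qed

text \<open>The stack occupies the cells from the head to the right, with its top under the head; the
  cells to the left of the head are irrelevant. Thus an input tape is a stack already.\<close>

fun stack_tape :: "nat list \<Rightarrow> tape \<Rightarrow> bool" where
  "stack_tape xs (f, p) \<longleftrightarrow> (\<forall>i::nat. f (p + int i) = (if i < length xs then xs ! i else 0))"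

lemma head_symbol_stack_tape: "stack_tape xs T \<Longrightarrow> head_symbol T = top0 xs"
  by (cases T; cases xs) (auto dest: spec[of _ 0])

lemma stack_tape_stay: "stack_tape xs T \<Longrightarrow> stack_tape xs (act_on_tape (head_symbol T, Stay) T)"
  by (cases T) auto

lemma stack_tape_pop:
  assumes "stack_tape xs T"
  shows "stack_tape (tl xs) (act_on_tape (head_symbol T, Move_Right) T)"
proof -
  obtain f p where T: "T = (f, p)" by fastforce
  have "f (p + 1 + int i) = (if i < length (tl xs) then tl xs ! i else 0)" for i
  proof -
    have "p + 1 + int i = p + int (Suc i)" by simp
    moreover have "f (p + int (Suc i)) = (if Suc i < length xs then xs ! Suc i else 0)"
      using assms unfolding T stack_tape.simps by blast
    ultimately show ?thesis by (simp only:) (auto simp: nth_tl)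
  qed
  then show ?thesis by (simp add: T)
qed

lemma stack_tape_push:
  assumes "stack_tape xs T"
  shows "stack_tape (a # xs) (act_on_tape (a, Stay) (act_on_tape (head_symbol T, Move_Left) T))"
proof -
  obtain f p where T: "T = (f, p)" by fastforce
  have "f (p + int i) = (if i < length xs then xs ! i else 0)" for i
    using assms by (simp add: T)
  then show ?thesis by (auto simp: T nth_Cons split: nat.split)
qed

section \<open>Simulation of stack programs by steps on command lists and tapes\<close>

definition stack_tapes :: "nat \<Rightarrow> stacks \<Rightarrow> tape list \<Rightarrow> bool" where
  "stack_tapes l s ts \<longleftrightarrow> length ts = l \<and> (\<forall>k<l. stack_tape (s k) (ts ! k))"

text \<open>An intermediate machine whose states are command lists, so that the simulation of
  programs is independent of the numbering of states and of halting.\<close>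

fun run_step :: "com list \<times> tape list \<Rightarrow> com list \<times> tape list" where
  "run_step (q, ts) = (case control_step q (map head_symbol ts) of (q', acts) \<Rightarrow> (q', map2 act_on_tape acts ts))"

lemma map2_idle: 
  "stack_tapes l s ts \<Longrightarrow>
   stack_tapes l s (map2 act_on_tape (map (\<lambda>a. (a, Stay)) (map head_symbol ts)) ts)"
  by (auto simp: stack_tapes_def intro!: stack_tape_stay)

lemma map2_update:
  assumes "stack_tapes l s ts" "k < l" "stack_tape xs (act_on_tape ad (ts ! k))"
  shows "stack_tapes l (s(k := xs)) (map2 act_on_tape ((map (\<lambda>a. (a, Stay)) (map head_symbol ts))[k := ad]) ts)"
  using assms by (auto simp: stack_tapes_def nth_list_update intro!: stack_tape_stay)

lemma funpow_add_apply: "(f ^^ a) x = y \<Longrightarrow> (f ^^ b) y = z \<Longrightarrow> (f ^^ (b + a)) x = z"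
  by (simp add: funpow_add)

lemma funpow_Suc_apply: "(f ^^ b) (f x) = z \<Longrightarrow> (f ^^ Suc b) x = z"
  by (simp add: funpow_swap1)

definition bounded_stacks :: "nat \<Rightarrow> nat \<Rightarrow> stacks \<Rightarrow> bool" where
  "bounded_stacks N m s \<longleftrightarrow> (\<forall>k. length (s k) \<le> N \<and> set (s k) \<subseteq> {..<m})"

text \<open>Only \<open>Push\<close> adds a symbol, and its rule checks the height. The bound on the
  symbols is what makes the chosen branch of a \<open>Case\<close> well-formed.\<close>

lemma exec_bounded_stacks:
  assumes "exec N c s s'" "wf_com l m c" "bounded_stacks N m s" "0 < m"
  shows "bounded_stacks N m s'"
  using assms(1-3)
proof (induction)
  case (Pop k s)
  have "length (tl (s k)) \<le> length (s k)" "set (tl (s k)) \<subseteq> set (s k)"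
    by (cases "s k"; auto)+
  with Pop show ?case unfolding bounded_stacks_def by (metis fun_upd_apply le_trans subset_trans)
next
  case (Case f s k s')
  have "top0 (s k) < m" using Case.prems(2) assms(4)
    by (cases "s k") (auto simp: bounded_stacks_def dest: spec[of _ k])
  then show ?case using Case by simp
qed (auto simp: bounded_stacks_def)

text \<open>The induction is on the command, for every continuation \<open>K\<close>: the first part
  of a sequence runs with the second below it, and a loop body runs with the loop below it.\<close>

lemma exec_run_step:
  assumes "exec N c s s'" "wf_com l m c" "bounded_stacks N m s" "0 < m" "stack_tapes l s ts"
  shows "\<exists>t ts'. t \<le> poly (time_poly m c) N \<and> (run_step ^^ t) (c # K, ts) = (K, ts') \<and> stack_tapes l s' ts'"
  using assms
proof (induction c arbitrary: s s' ts K)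
  case Skip
  then show ?case using map2_idle[OF Skip.prems(5)]
    by (intro exI[of _ 1]) (auto elim!: exec_SkipE)
next
  case (Push k a)
  let ?acts = "(map (\<lambda>a. (a, Stay)) (map head_symbol ts))[k := (map head_symbol ts ! k, Move_Left)]"
  let ?ts1 = "map2 act_on_tape ?acts ts"
  let ?ts2 = "map2 act_on_tape ((map (\<lambda>a. (a, Stay)) (map head_symbol ?ts1))[k := (a, Stay)]) ?ts1"
  have len: "length ts = l" and k: "k < l" using Push.prems by (auto simp: stack_tapes_def)
  have s': "s' = s(k := a # s k)" using Push.prems(1) by (auto elim: exec_PushE)
  have "(run_step ^^ 2) (Push k a # K, ts) = (K, ?ts2)"
    by (simp add: eval_nat_numeral)
  moreover have "stack_tapes l s' ?ts2"
    using Push.prems(5) k len unfolding s' stack_tapes_def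
    by (auto simp: nth_list_update intro!: stack_tape_stay stack_tape_push)
  ultimately show ?case by (intro exI[of _ 2]) (auto simp del: One_nat_def)
next
  case (Put k a)
  then show ?case by (auto elim: exec_PutE)
next
  case (Pop k)
  have k: "k < l" "length ts = l" using Pop.prems by (auto simp: stack_tapes_def)
  have s': "s' = s(k := tl (s k))" using Pop.prems(1) by (auto elim: exec_PopE)
  have "stack_tape (s k) (ts ! k)" using Pop.prems(5) k by (simp add: stack_tapes_def)
  from stack_tape_pop[OF this] have "stack_tapes l s' (snd (run_step (Pop k # K, ts)))"
    using map2_update[OF Pop.prems(5) k(1), of "tl (s k)" "(head_symbol (ts ! k), Move_Right)"] k by (simp add: s')
  then show ?case by (intro exI[of _ 1]) auto
next
  case (Seq c d)
  from Seq.prems(1) obtain s1 where s1: "exec N c s s1" "exec N d s1 s'" by (auto elim: exec_SeqE)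
  have wf: "wf_com l m c" "wf_com l m d" using Seq.prems by auto
  let ?ts = "snd (run_step ((c ;; d) # K, ts))"
  have "stack_tapes l s ?ts" using map2_idle[OF Seq.prems(5)] by simp
  from Seq.IH(1)[OF s1(1) wf(1) Seq.prems(3,4) this, of "d # K"] obtain t1 ts1 where
    1: "t1 \<le> poly (time_poly m c) N" "(run_step ^^ t1) (c # d # K, ?ts) = (d # K, ts1)" "stack_tapes l s1 ts1"
    by blast
  from Seq.IH(2)[OF s1(2) wf(2) exec_bounded_stacks[OF s1(1) wf(1) Seq.prems(3,4)] Seq.prems(4) 1(3), of K]
  obtain t2 ts2 where
    2: "t2 \<le> poly (time_poly m d) N" "(run_step ^^ t2) (d # K, ts1) = (K, ts2)" "stack_tapes l s' ts2"
    by blast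
  have "(run_step ^^ Suc (t2 + t1)) ((c ;; d) # K, ts) = (K, ts2)"
    by (rule funpow_Suc_apply, rule funpow_add_apply[OF _ 2(2)]) (use 1(2) in simp)
  then show ?case using 1(1) 2(1,3) by (intro exI[of _ "Suc (t2 + t1)"]) auto
next
  case (Case k f)
  have k: "k < l" "length ts = l" using Case.prems by (auto simp: stack_tapes_def)
  have hd: "map head_symbol ts ! k = top0 (s k)"
    using Case.prems(5) k by (auto simp: stack_tapes_def intro!: head_symbol_stack_tape)
  have ex: "exec N (f (top0 (s k))) s s'" using Case.prems(1) by (auto elim: exec_CaseE)
  have lt: "top0 (s k) < m" using Case.prems(3,4)
    by (cases "s k") (auto simp: bounded_stacks_def dest: spec[of _ k])
  let ?ts = "snd (run_step (Case k f # K, ts))"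
  have "stack_tapes l s ?ts" using map2_idle[OF Case.prems(5)] by simp
  with Case.IH[OF _ ex _ Case.prems(3,4), of ?ts K] lt Case.prems(2) obtain t1 ts1 where
    1: "t1 \<le> poly (time_poly m (f (top0 (s k)))) N" "(run_step ^^ t1) (f (top0 (s k)) # K, ?ts) = (K, ts1)"
      "stack_tapes l s' ts1"
    by auto
  have "(run_step ^^ Suc t1) (Case k f # K, ts) = (K, ts1)"
    by (rule funpow_Suc_apply) (use 1(2) hd in simp)
  moreover have "poly (time_poly m (f (top0 (s k)))) N \<le> (\<Sum>a<m. poly (time_poly m (f a)) N)"
    using lt by (intro member_le_sum[where f = "\<lambda>a. poly (time_poly m (f a)) N"]) auto
  ultimately show ?case using 1(1,3) by (intro exI[of _ "Suc t1"]) (auto simp: poly_sum)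
next
  case (While k P c)
  have wf: "k < l" "wf_com l m c" using While.prems by auto
  let ?b = "poly (time_poly m c) N"
  \<comment> \<open>Each round costs one test and at most \<open>?b\<close> steps of the body and
    removes at least one symbol from stack \<open>k\<close>; the leading 1 is the failing test. An
    inner induction on this length is needed because after a round the same loop is executed
    again.\<close>
  have "\<exists>t ts'. t \<le> 1 + length (s k) * (1 + ?b) \<and>
      (run_step ^^ t) (While k P c # K, ts) = (K, ts') \<and> stack_tapes l s' ts'"
    using While.prems(1,3,5)
  proof (induction "length (s k)" arbitrary: s ts rule: less_induct)
    case less
    have "length ts = l" using less.prems by (auto simp: stack_tapes_def)
    then have hd: "map head_symbol ts ! k = top0 (s k)"
      using less.prems(3) wf(1) by (auto simp: stack_tapes_def intro!: head_symbol_stack_tape)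
    let ?ts = "snd (run_step (While k P c # K, ts))"
    have st: "stack_tapes l s ?ts" using map2_idle[OF less.prems(3)] by simp
    from less.prems(1) show ?case
    proof (cases rule: exec_WhileE)
      assume s': "s' = s" and P: "\<not> P (top0 (s k))"
      have "run_step (While k P c # K, ts) = (K, ?ts)" using hd P by simp
      then have "(run_step ^^ 1) (While k P c # K, ts) = (K, ?ts)" by simp
      then show ?thesis using st s' by (intro exI[of _ 1] exI[of _ ?ts]) auto
    next
      fix s1
      assume 2: "P (top0 (s k))" "exec N c s s1" "length (s1 k) < length (s k)"
        "exec N (While k P c) s1 s'"
      from While.IH[OF 2(2) wf(2) less.prems(2) While.prems(4) st] obtain t1 ts1 where
        t1: "t1 \<le> ?b" "(run_step ^^ t1) (c # While k P c # K, ?ts) = (While k P c # K, ts1)"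
          "stack_tapes l s1 ts1" by blast
      from less.hyps[OF 2(3,4) exec_bounded_stacks[OF 2(2) wf(2) less.prems(2) While.prems(4)] t1(3)]
      obtain t2 ts2 where t2: "t2 \<le> 1 + length (s1 k) * (1 + ?b)"
        "(run_step ^^ t2) (While k P c # K, ts1) = (K, ts2)" "stack_tapes l s' ts2" by blast
      have "(run_step ^^ Suc (t2 + t1)) (While k P c # K, ts) = (K, ts2)"
        by (rule funpow_Suc_apply, rule funpow_add_apply[OF _ t2(2)]) (use t1(2) hd 2(1) in simp)
      moreover have "Suc (t2 + t1) \<le> 1 + length (s k) * (1 + ?b)"
      proof -
        have "Suc (length (s1 k)) * (1 + ?b) \<le> length (s k) * (1 + ?b)"
          using 2(3) by (intro mult_right_mono) auto
        then show ?thesis using t1(1) t2(1) by simp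
      qed
      ultimately show ?thesis using t2(3) by blast
    qed
  qed
  moreover have "1 + length (s k) * (1 + ?b) \<le> poly (time_poly m (While k P c)) N"
    using While.prems(3) by (simp add: bounded_stacks_def add_mono mult_right_mono)
  ultimately show ?case by (meson le_trans)
qed

text \<open>The control states are numbered arbitrarily; \<open>Inl b\<close> halts with answer \<open>b\<close>, which is read off
  the stack \<open>r\<close> when no command is left.\<close>

definition controls :: "nat \<Rightarrow> com \<Rightarrow> (bool + com list) set" where
  "controls m c = range Inl \<union> Inr ` insert [] (reachable m c [])"

lemma finite_controls: "finite (controls m c)"
  by (simp add: controls_def finite_reachable)

definition number :: "nat \<Rightarrow> com \<Rightarrow> bool + com list \<Rightarrow> nat" where
  "number m c = (SOME h. bij_betw h (controls m c) {..<card (controls m c)})"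

lemma bij_number: "bij_betw (number m c) (controls m c) {..<card (controls m c)}"
  unfolding number_def atLeast0LessThan[symmetric]
  by (rule someI_ex[OF ex_bij_betw_finite_nat[OF finite_controls]])

definition machine :: "nat \<Rightarrow> nat \<Rightarrow> nat \<Rightarrow> com \<Rightarrow> turing_machine" where
  "machine l m r c = \<lparr>num_tapes = l, num_states = card (controls m c), num_symbols = m,
     start_state = number m c (Inr [c]), accept_state = number m c (Inl True),
     reject_state = number m c (Inl False),
     delta = (\<lambda>q ss. case inv_into (controls m c) (number m c) q of
         Inl b \<Rightarrow> (number m c (Inl b), map (\<lambda>a. (a, Stay)) ss)
       | Inr q' \<Rightarrow>
           (number m c (if q' = [] then Inl (ss ! r \<noteq> 0) else Inr (fst (control_step q' ss))),
            snd (control_step q' ss)))\<rparr>"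

section \<open>From command lists to numbered states of a Turing machine\<close>

context
  fixes l m r :: nat and c :: com
  assumes wf: "wf_com l m c" and l: "r < l" and m: "0 < m"
begin

lemma number_eq_iff:
  "x \<in> controls m c \<Longrightarrow> y \<in> controls m c \<Longrightarrow> number m c x = number m c y \<longleftrightarrow> x = y"
  using bij_number by (metis bij_betw_def inj_on_eq_iff)

lemma number_less: "x \<in> controls m c \<Longrightarrow> number m c x < card (controls m c)"
  using bij_number by (metis bij_betwE lessThan_iff)

lemma inv_number: "x \<in> controls m c \<Longrightarrow> inv_into (controls m c) (number m c) (number m c x) = x"
  using bij_number by (metis bij_betw_inv_into_left)

lemma Inl_controls: "Inl b \<in> controls m c"
  by (simp add: controls_def)

lemma Nil_controls: "Inr [] \<in> controls m c"
  by (simp add: controls_def)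

lemma control_step_controls:
  assumes "Inr q \<in> controls m c" "length ss = l" "set ss \<subseteq> {..<m}"
  shows "Inr (fst (control_step q ss)) \<in> controls m c \<and> length (snd (control_step q ss)) = l \<and>
    fst ` set (snd (control_step q ss)) \<subseteq> {..<m}"
proof (cases "q = []")
  case True
  then show ?thesis using assms by (auto simp: controls_def image_image)
next
  case False
  then have "q \<in> reachable m c []" using assms(1) by (auto simp: controls_def)
  from control_step_in_reachable[OF wf this assms(2,3)] show ?thesis by (auto simp: controls_def)
qed

lemma wf_machine_machine: "wf_machine (machine l m r c)"
  unfolding wf_machine_def
proof (intro conjI allI impI)
  show "accept_state (machine l m r c) \<noteq> reject_state (machine l m r c)"
    by (simp add: machine_def number_eq_iff Inl_controls)
next
  fix q ss
  assume q: "q < num_states (machine l m r c)" and ss: "length ss = num_tapes (machine l m r c)"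
    "set ss \<subseteq> {..<num_symbols (machine l m r c)}"
  then obtain x where x: "x \<in> controls m c" "q = number m c x"
    using bij_number[of m c] by (auto simp: machine_def bij_betw_def image_iff)
  show "case delta (machine l m r c) q ss of (q', acts) \<Rightarrow> q' < num_states (machine l m r c) \<and>
      length acts = num_tapes (machine l m r c) \<and> fst ` set acts \<subseteq> {..<num_symbols (machine l m r c)}"
  proof (cases x)
    case (Inl b)
    then show ?thesis using x ss by (auto simp: machine_def inv_number number_less image_image)
  next
    case (Inr q')
    then show ?thesis using x ss control_step_controls[of q' ss]
      by (auto simp: machine_def inv_number number_less Inl_controls)
  qed
next
  have "Inr [c] \<in> controls m c" using Cons_in_reachable by (auto simp: controls_def)
  then show "start_state (machine l m r c) < num_states (machine l m r c)"
    by (simp add: machine_def number_less)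
qed (use l m in \<open>simp_all add: machine_def number_less Inl_controls\<close>)

text \<open>All cells are constrained, not only those of the stack: a push moves the head onto a
  discarded cell to its left, whose symbol is then read before it is overwritten.\<close>

definition bounded_tapes :: "tape list \<Rightarrow> bool" where
  "bounded_tapes ts \<longleftrightarrow> length ts = l \<and> (\<forall>T\<in>set ts. \<forall>i. fst T i < m)"

lemma bounded_tapes_heads:
  "bounded_tapes ts \<Longrightarrow> length (map head_symbol ts) = l \<and> set (map head_symbol ts) \<subseteq> {..<m}"
  by (force simp: bounded_tapes_def)

lemma bounded_tapes_act:
  assumes "bounded_tapes ts" "length acts = l" "fst ` set acts \<subseteq> {..<m}"
  shows "bounded_tapes (map2 act_on_tape acts ts)"
proof -
  have "fst (act_on_tape ad T) i < m" if "(ad, T) \<in> set (zip acts ts)" for ad T i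
  proof -
    obtain a d f p where "ad = (a, d)" "T = (f, p)" by fastforce
    moreover from this have "a < m"
      using assms(3) set_zip_leftD[OF that] by force
    moreover have "f i < m" for i
      using \<open>T = (f, p)\<close> assms(1) set_zip_rightD[OF that] by (force simp: bounded_tapes_def)
    ultimately show ?thesis by simp
  qed
  then show ?thesis using assms by (auto simp: bounded_tapes_def)
qed

lemma step_machine:
  assumes "q \<noteq> []" "Inr q \<in> controls m c" "bounded_tapes ts" "run_step (q, ts) = (q', ts')"
  shows "step (machine l m r c) (number m c (Inr q), ts) = (number m c (Inr q'), ts') \<and>
    Inr q' \<in> controls m c \<and> bounded_tapes ts'"
  using assms control_step_controls[OF assms(2) conjunct1 conjunct2, OF bounded_tapes_heads bounded_tapes_heads,
      OF assms(3) assms(3)] bounded_tapes_act[OF assms(3)]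
  by (auto simp: machine_def number_eq_iff Inl_controls inv_number split: prod.splits)

lemma run_step_Nil: "run_step ([], ts) = ([], ts)"
proof -
  have "act_on_tape (head_symbol T, Stay) T = T" for T
    by (cases T) auto
  from this[of "ts ! i" for i] show ?thesis
    by (auto simp del: act_on_tape.simps head_symbol.simps intro!: nth_equalityI)
qed

text \<open>On the empty command list \<open>run_step\<close> idles while the machine proceeds to a
  halting state, so the machine is followed only up to the first arrival there, which may be earlier
  than \<open>t\<close>.\<close>

lemma steps_machine:
  assumes "Inr q \<in> controls m c" "bounded_tapes ts" "(run_step ^^ t) (q, ts) = ([], ts')"
  shows "bounded_tapes ts' \<and>
    (\<exists>t'\<le>t. (step (machine l m r c) ^^ t') (number m c (Inr q), ts) = (number m c (Inr []), ts'))"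
  using assms
proof (induction t arbitrary: q ts)
  case 0
  then show ?case by auto
next
  case (Suc t)
  show ?case
  proof (cases "q = []")
    case True
    have "(run_step ^^ Suc t) ([], ts) = ([], ts)"
      by (induction t) (simp_all add: run_step_Nil del: run_step.simps)
    then show ?thesis using Suc.prems True by (auto intro!: exI[of _ 0])
  next
    case False
    obtain q1 ts1 where 1: "run_step (q, ts) = (q1, ts1)" by fastforce
    from step_machine[OF False Suc.prems(1,2) 1] have
      2: "step (machine l m r c) (number m c (Inr q), ts) = (number m c (Inr q1), ts1)"
        "Inr q1 \<in> controls m c" "bounded_tapes ts1" by auto
    have "(run_step ^^ t) (q1, ts1) = ([], ts')"
      using Suc.prems(3) 1 by (simp add: funpow_swap1 del: run_step.simps)
    from Suc.IH[OF 2(2,3) this] obtain t' where 3: "bounded_tapes ts'" "t' \<le> t"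
      "(step (machine l m r c) ^^ t') (number m c (Inr q1), ts1) = (number m c (Inr []), ts')"
      by blast
    have "(step (machine l m r c) ^^ Suc t') (number m c (Inr q), ts) = (number m c (Inr []), ts')"
      by (rule funpow_Suc_apply) (use 2(1) 3(3) in simp)
    then show ?thesis using 3 by (meson Suc_le_mono)
  qed
qed

lemma step_halted: "(step (machine l m r c) ^^ t) (number m c (Inl b), ts) = (number m c (Inl b), ts)"
proof -
  have "step (machine l m r c) (number m c (Inl b), ts) = (number m c (Inl b), ts)"
    by (cases b) (simp_all add: machine_def)
  then show ?thesis by (induction t) simp_all
qed

text \<open>The additional step is the transition from the empty command list to the halting state
  selected by the top of stack \<open>r\<close>.\<close>

lemma machine_answers_within:
  assumes ex: "exec N c (\<lambda>k. if k = 0 then xs else []) s'"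
    and xs: "set xs \<subseteq> {..<m}" "length xs \<le> N"
  shows "answers_within (machine l m r c) xs (top0 (s' r) \<noteq> 0) (poly (time_poly m c) N + 1)"
proof -
  let ?M = "machine l m r c" and ?s = "\<lambda>k::nat. if k = 0 then xs else []"
  define ts where "ts = input_tape xs # replicate (l - 1) (input_tape [])"
  have init: "initial_config ?M xs = (number m c (Inr [c]), ts)"
    by (simp add: initial_config_def machine_def ts_def)
  have st: "stack_tapes l ?s ts"
    using l by (auto simp: stack_tapes_def ts_def input_tape_def nth_Cons split: nat.split)
  have bs: "bounded_stacks N m ?s" using xs by (auto simp: bounded_stacks_def)
  have "xs ! i < m" if "i < length xs" for i using xs that nth_mem by blast
  then have bt: "bounded_tapes ts"
    using l m by (auto simp: bounded_tapes_def ts_def input_tape_def nat_less_iff)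
  from exec_run_step[OF ex wf bs m st, of "[]"] obtain t ts' where
    t: "t \<le> poly (time_poly m c) N" "(run_step ^^ t) ([c], ts) = ([], ts')" "stack_tapes l s' ts'"
    by blast
  have "Inr [c] \<in> controls m c" using Cons_in_reachable by (auto simp: controls_def)
  from steps_machine[OF this bt t(2)] obtain t' where
    t': "bounded_tapes ts'" "t' \<le> t" "(step ?M ^^ t') (initial_config ?M xs) = (number m c (Inr []), ts')"
    unfolding init by blast
  have hd: "map head_symbol ts' ! r = top0 (s' r)"
    using t(3) l by (auto simp: stack_tapes_def intro!: head_symbol_stack_tape)
  let ?b = "top0 (s' r) \<noteq> 0"
  have "step ?M (number m c (Inr []), ts') = (number m c (Inl ?b), snd (run_step ([], ts')))"
    using hd by (simp add: machine_def number_eq_iff Inl_controls inv_number Nil_controls)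
  then have "(step ?M ^^ Suc t') (initial_config ?M xs) = (number m c (Inl ?b), snd (run_step ([], ts')))"
    using t'(3) by simp
  \<comment> \<open>The answer is required after an exact number of steps; the halted configuration
    absorbs the surplus.\<close>
  then have "(step ?M ^^ (T - Suc t' + Suc t')) (initial_config ?M xs)
      = (number m c (Inl ?b), snd (run_step ([], ts')))" for T
    by (rule funpow_add_apply[OF _ step_halted])
  from this[of "poly (time_poly m c) N + 1"]
  have "(step ?M ^^ (poly (time_poly m c) N + 1)) (initial_config ?M xs)
      = (number m c (Inl ?b), snd (run_step ([], ts')))"
    using t(1) t'(2) by simp
  then show ?thesis by (simp add: answers_within_def machine_def)
qed

end

text \<open>It suffices to bound the stack heights by a polynomial \<open>p\<close> of the input
  length; the running time is then the composition of \<open>time_poly\<close> with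
  \<open>p\<close>, plus the halting step. The input is itself a stack, so \<open>p\<close> must
  bound its length as well.\<close>

theorem polynomial_time_decidableI:
  assumes wf: "wf_com l m c" "r < l" "0 < m"
    and enc: "\<And>i. i \<in> I \<Longrightarrow> set (enc i) \<subseteq> {1..<m}"
    and exec: "\<And>i. i \<in> I \<Longrightarrow> length (enc i) \<le> poly p (length (enc i)) \<and>
      (\<exists>s. exec (poly p (length (enc i))) c (\<lambda>k. if k = 0 then enc i else []) s \<and> (top0 (s r) \<noteq> 0 \<longleftrightarrow> P i))"
  shows "polynomial_time_decidable enc I P"
  unfolding polynomial_time_decidable_def
proof (intro exI conjI ballI)
  show "wf_machine (machine l m r c)" using wf by (rule wf_machine_machine)
next
  fix i assume i: "i \<in> I"
  then show "set (enc i) \<subseteq> {1..<num_symbols (machine l m r c)}"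
    using enc by (simp add: machine_def)
  obtain s where s: "exec (poly p (length (enc i))) c (\<lambda>k. if k = 0 then enc i else []) s"
      "top0 (s r) \<noteq> 0 \<longleftrightarrow> P i" "length (enc i) \<le> poly p (length (enc i))"
    using exec[OF i] by blast
  have "set (enc i) \<subseteq> {..<m}" using enc[OF i] by auto
  from machine_answers_within[OF wf s(1) this s(3)]
  show "answers_within (machine l m r c) (enc i) (P i)
      (poly (pcompose (time_poly m c) p + [:1:]) (length (enc i)))"
    using s(2) by (simp add: poly_pcompose)
qed

section \<open>Weakest preconditions and binary addition\<close>

text \<open>Total correctness within height \<open>N\<close>. For loop-free commands the
  precondition is computed by simplification, and every push leaves its height condition as a proof
  obligation.\<close>

definition wp :: "nat \<Rightarrow> com \<Rightarrow> (stacks \<Rightarrow> bool) \<Rightarrow> stacks \<Rightarrow> bool" where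
  "wp N c Q s \<longleftrightarrow> (\<exists>s'. exec N c s s' \<and> Q s')"

lemma wp_Skip [simp]: "wp N Skip Q s \<longleftrightarrow> Q s"
  by (auto simp: wp_def intro: exec.Skip elim: exec_SkipE)

lemma wp_Push [simp]: "wp N (Push k a) Q s \<longleftrightarrow> length (s k) < N \<and> Q (s(k := a # s k))"
  by (auto simp: wp_def intro: exec.Push elim: exec_PushE)

lemma wp_Pop [simp]: "wp N (Pop k) Q s \<longleftrightarrow> Q (s(k := tl (s k)))"
  by (auto simp: wp_def intro: exec.Pop elim: exec_PopE)

lemma wp_Seq [simp]: "wp N (c ;; d) Q s \<longleftrightarrow> wp N c (wp N d Q) s"
  by (auto simp: wp_def intro: exec.Seq elim!: exec_SeqE)

lemma wp_Case [simp]: "wp N (Case k f) Q s \<longleftrightarrow> wp N (f (top0 (s k))) Q s"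
  by (auto simp: wp_def intro: exec.Case elim: exec_CaseE)

lemma wp_if [simp]: "wp N (if b then c else d) Q s \<longleftrightarrow> (if b then wp N c Q s else wp N d Q s)"
  by simp

lemma wp_mono: "wp N c Q s \<Longrightarrow> (\<And>s'. Q s' \<Longrightarrow> R s') \<Longrightarrow> wp N c R s"
  by (auto simp: wp_def)

lemma wp_While_False: "\<not> P (top0 (s k)) \<Longrightarrow> Q s \<Longrightarrow> wp N (While k P c) Q s"
  by (auto simp: wp_def intro: exec.While_False)

lemma wp_While_True:
  "P (top0 (s k)) \<Longrightarrow> wp N c (\<lambda>s'. length (s' k) < length (s k) \<and> wp N (While k P c) Q s') s \<Longrightarrow>
   wp N (While k P c) Q s"
  by (auto simp: wp_def intro: exec.While_True)

text \<open>No separate variant is needed: the semantics already forces the controlling stack to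
  become shorter.\<close>

lemma wp_While_inv:
  assumes "I s"
    and "\<And>s. I s \<Longrightarrow> P (top0 (s k)) \<Longrightarrow> wp N c (\<lambda>s'. I s' \<and> length (s' k) < length (s k)) s"
    and "\<And>s. I s \<Longrightarrow> \<not> P (top0 (s k)) \<Longrightarrow> Q s"
  shows "wp N (While k P c) Q s"
  using assms(1)
proof (induction "length (s k)" arbitrary: s rule: less_induct)
  case less
  show ?case
  proof (cases "P (top0 (s k))")
    case True
    have "wp N c (\<lambda>s'. length (s' k) < length (s k) \<and> wp N (While k P c) Q s') s"
      by (rule wp_mono[OF assms(2)[OF less.prems True]]) (use less.hyps in auto)
    with True show ?thesis by (rule wp_While_True)
  next
    case False
    then show ?thesis using assms(3) less.prems by (intro wp_While_False) auto
  qed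
qed

definition nonblank :: "nat \<Rightarrow> bool" where
  "nonblank a \<longleftrightarrow> a \<noteq> 0"

lemma nonblank_simps [simp]: "\<not> nonblank 0" "nonblank (Suc n)" "nonblank (numeral v)" "nonblank 1"
  by (simp_all add: nonblank_def)

section \<open>Moving, clearing and copying stacks\<close>

definition move_while :: "(nat \<Rightarrow> bool) \<Rightarrow> nat \<Rightarrow> nat \<Rightarrow> com" where
  "move_while P x y = While x P (Case x (\<lambda>a. Pop x ;; Push y a))"

lemma wp_move_while:
  assumes "\<not> P 0" "x \<noteq> y" "length (takeWhile P (s x)) + length (s y) \<le> N"
    and "Q (s(x := dropWhile P (s x), y := rev (takeWhile P (s x)) @ s y))"
  shows "wp N (move_while P x y) Q s"
  using assms(3,4)
proof (induction "s x" arbitrary: s)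
  case Nil
  then have eq: "s(x := dropWhile P (s x), y := rev (takeWhile P (s x)) @ s y) = s"
    by (auto simp: fun_eq_iff simp flip: Nil.hyps)
  have "Q s" using Nil.prems(2) by (simp only: eq)
  with assms(1) show ?case
    unfolding move_while_def by (intro wp_While_False) (simp_all flip: Nil.hyps)
next
  case (Cons a xs)
  show ?case
  proof (cases "P a")
    case True
    let ?s = "s(x := xs, y := a # s y)"
    have "wp N (move_while P x y) Q ?s"
      using Cons.prems True assms(2) by (intro Cons.hyps(1)) (simp_all flip: Cons.hyps(2))
    then show ?thesis
      using True Cons.prems(1) assms(2) unfolding move_while_def
      by (intro wp_While_True) (simp_all flip: Cons.hyps(2))
  next
    case False
    then have "s(x := dropWhile P (s x), y := rev (takeWhile P (s x)) @ s y) = s"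
      by (auto simp: fun_eq_iff simp flip: Cons.hyps(2))
    with False Cons.prems(2) show ?thesis
      unfolding move_while_def by (intro wp_While_False) (simp_all flip: Cons.hyps(2))
  qed
qed

lemma wf_move_while [simp]: "wf_com l m (move_while P x y) \<longleftrightarrow> x < l \<and> (0 < m \<longrightarrow> y < l)"
  by (auto simp: move_while_def)

abbreviation move :: "nat \<Rightarrow> nat \<Rightarrow> com" where
  "move \<equiv> move_while nonblank"

lemma wp_move:
  assumes "x \<noteq> y" "0 \<notin> set (s x)" "length (s x) + length (s y) \<le> N"
    and "Q (s(x := [], y := rev (s x) @ s y))"
  shows "wp N (move x y) Q s"
proof -
  have "takeWhile nonblank (s x) = s x" "dropWhile nonblank (s x) = []"
    using assms(2) by (auto simp: takeWhile_eq_all_conv dropWhile_eq_Nil_conv nonblank_def intro: ccontr)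
  then show ?thesis using assms by (intro wp_move_while) (simp_all del: takeWhile_eq_all_conv dropWhile_eq_Nil_conv)
qed

definition clear :: "nat \<Rightarrow> com" where
  "clear x = While x nonblank (Pop x)"

lemma wf_clear [simp]: "wf_com l m (clear x) \<longleftrightarrow> x < l"
  by (simp add: clear_def)

lemma wp_clear: "0 \<notin> set (s x) \<Longrightarrow> Q (s(x := [])) \<Longrightarrow> wp N (clear x) Q s"
proof (induction "s x" arbitrary: s)
  case Nil
  then have "s(x := []) = s" by (auto simp: fun_eq_iff)
  with Nil show ?case unfolding clear_def by (intro wp_While_False) (simp_all flip: Nil(1))
next
  case (Cons a xs)
  have "a \<noteq> 0" using Cons.prems(1) by (auto simp flip: Cons.hyps(2))
  moreover have "wp N (clear x) Q (s(x := xs))"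
    using Cons.prems by (intro Cons.hyps(1)) (auto simp flip: Cons.hyps(2))
  ultimately show ?case unfolding clear_def
    by (intro wp_While_True) (simp_all add: nonblank_def flip: Cons.hyps(2))
qed

text \<open>Reading a stack destroys it, so copying needs two targets, one of which restores the
  original. Both receive the content reversed, which a preceding \<open>move\<close>
  compensates.\<close>

definition copy2 :: "nat \<Rightarrow> nat \<Rightarrow> nat \<Rightarrow> com" where
  "copy2 x y z = While x nonblank (Case x (\<lambda>a. Pop x ;; Push y a ;; Push z a))"

lemma wf_copy2 [simp]: "wf_com l m (copy2 x y z) \<longleftrightarrow> x < l \<and> (0 < m \<longrightarrow> y < l \<and> z < l)"
  by (auto simp: copy2_def)

lemma wp_copy2:
  assumes "distinct [x, y, z]" "0 \<notin> set (s x)" "length (s x) + length (s y) \<le> N"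
    "length (s x) + length (s z) \<le> N"
    and "Q (s(x := [], y := rev (s x) @ s y, z := rev (s x) @ s z))"
  shows "wp N (copy2 x y z) Q s"
  using assms(2-)
proof (induction "s x" arbitrary: s)
  case Nil
  then have eq: "s(x := [], y := rev (s x) @ s y, z := rev (s x) @ s z) = s"
    by (auto simp: fun_eq_iff simp flip: Nil.hyps)
  have "Q s" using Nil.prems(4) by (simp only: eq)
  then show ?case unfolding copy2_def by (intro wp_While_False) (simp_all flip: Nil.hyps)
next
  case (Cons a xs)
  have "a \<noteq> 0" using Cons.prems(1) by (auto simp flip: Cons.hyps(2))
  moreover have "wp N (copy2 x y z) Q (s(x := xs, y := a # s y, z := a # s z))"
    using Cons.prems assms(1) by (intro Cons.hyps(1)) (auto simp flip: Cons.hyps(2) simp: fun_upd_twist)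
  ultimately show ?case unfolding copy2_def
    using Cons.prems assms(1)
    by (intro wp_While_True) (simp_all add: nonblank_def flip: Cons.hyps(2))
qed

section \<open>Binary numbers and their addition\<close>

text \<open>Numbers are lists of the letter codes 1 and 2 of the digits 0 and 1, least significant first,
  possibly with leading zeros.\<close>

definition is_bit :: "nat \<Rightarrow> bool" where
  "is_bit a \<longleftrightarrow> a = 1 \<or> a = 2"

text \<open>The blank also has value 0, so a number whose stack is exhausted continues with zeros;
  operands of different lengths need no padding.\<close>

definition dig :: "nat \<Rightarrow> nat" where
  "dig a = (if a = 2 then 1 else 0)"

fun bits_val :: "nat list \<Rightarrow> nat" where
  "bits_val [] = 0"
| "bits_val (a # xs) = dig a + 2 * bits_val xs"

lemma is_bit_simps [simp]: "\<not> is_bit 0" "is_bit 1" "is_bit (Suc 0)" "is_bit 2"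
  by (simp_all add: is_bit_def)

lemma dig_simps [simp]: "dig 0 = 0" "dig 1 = 0" "dig (Suc 0) = 0" "dig 2 = 1"
  by (simp_all add: dig_def)

lemma bits_val_append: "bits_val (xs @ ys) = bits_val xs + 2 ^ length xs * bits_val ys"
  by (induction xs) (auto simp: algebra_simps)

definition bits :: "nat list \<Rightarrow> bool" where
  "bits xs \<longleftrightarrow> (\<forall>a\<in>set xs. is_bit a)"

lemma bits_simps [simp]: "bits []" "bits (a # xs) \<longleftrightarrow> is_bit a \<and> bits xs"
  "bits (xs @ ys) \<longleftrightarrow> bits xs \<and> bits ys" "bits (rev xs) \<longleftrightarrow> bits xs"
  by (auto simp: bits_def)

lemma bits_zero_notin: "bits xs \<Longrightarrow> 0 \<notin> set xs"
  by (auto simp: bits_def)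

lemma bits_tl: "bits xs \<Longrightarrow> bits (tl xs)"
  by (cases xs) auto

lemma bits_top0: "bits xs \<Longrightarrow> nonblank (top0 xs) \<longleftrightarrow> xs \<noteq> []"
  by (cases xs) (auto simp: nonblank_def is_bit_def)

lemma bits_val_tl: "bits_val xs = dig (top0 xs) + 2 * bits_val (tl xs)"
  by (cases xs) auto

text \<open>Use of the stacks in the program:
  \<^item> 0: the terms of the inequality; 1: the variables still to be tested; 2: the current variable;
  \<^item> 3: the part of the current variable already matched with the word being read;
  \<^item> 4: a copy of the terms, consumed while the current variable is tested;
  \<^item> 5, 6, 7: in an addition, the used digits of the summand that is kept, the digits of the sum in
    reverse order, and the carry; 5 also serves for reversing, 7 as the flag of a comparison;
  \<^item> 8, 9: numerator \<open>A\<close> and denominator \<open>B\<close> of the sum of weights;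
  \<^item> 10, 11, 12: the candidates for \<open>A\<close> and \<open>B\<close> after the current term, and the summand \<open>b A\<close>;
  \<^item> 13, 14, 15: flags (nonempty means true) for a match of words, for \<open>x \<in> V - U\<close>, and for the answer.\<close>

definition add_step :: "nat \<Rightarrow> nat \<Rightarrow> com" where
  "add_step x y = Case x (\<lambda>a. Case y (\<lambda>b. Case 7 (\<lambda>c.
     Pop x ;; Pop y ;; Pop 7 ;; (if a = 0 then Skip else Push 5 a) ;;
     Push 6 (if odd (dig a + dig b + dig c) then 2 else 1) ;;
     (if 2 \<le> dig a + dig b + dig c then Push 7 2 else Skip))))"

text \<open>The sum replaces \<open>y\<close>, while \<open>x\<close> is rebuilt from stack 5. A
  loop is controlled by one stack only, so a second loop treats the remaining digits of a longer
  \<open>y\<close>; the last carry becomes an extra digit.\<close>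

definition add_to :: "nat \<Rightarrow> nat \<Rightarrow> com" where
  "add_to x y = While x nonblank (add_step x y) ;; While y nonblank (add_step x y) ;;
     Case 7 (\<lambda>c. if c = 0 then Skip else Pop 7 ;; Push 6 2) ;;
     move 5 x ;; move 6 y"

lemma wf_add_to [simp]:
  "wf_com l m (add_to x y) \<longleftrightarrow> x < l \<and> y < l" if "8 \<le> l" "3 \<le> m"
  using that by (auto simp: add_to_def add_step_def)

text \<open>The digits already produced, plus the unread parts and the carry shifted to their
  position, always give the full sum. Each step consumes one position of both operands, whence the
  equation between lengths; it bounds the heights.\<close>

definition add_inv :: "nat \<Rightarrow> nat \<Rightarrow> stacks \<Rightarrow> stacks \<Rightarrow> bool" where
  "add_inv x y s0 s \<longleftrightarrow> (\<forall>k. k \<notin> {5, 6, 7, x, y} \<longrightarrow> s k = s0 k) \<and>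
     rev (s 5) @ s x = s0 x \<and> bits (s y) \<and> bits (s 6) \<and>
     s 7 \<in> {[], [2]} \<and>
     bits_val (rev (s 6)) + 2 ^ length (s 6) * (bits_val (s x) + bits_val (s y) + dig (top0 (s 7)))
       = bits_val (s0 x) + bits_val (s0 y) \<and>
     length (s 6) + max (length (s x)) (length (s y)) = max (length (s0 x)) (length (s0 y))"

lemma wp_add_step:
  assumes inv: "add_inv x y s0 s" and xy: "x \<noteq> y" "x \<notin> {5, 6, 7}" "y \<notin> {5, 6, 7}"
    and b: "bits (s0 x)" and N: "max (length (s0 x)) (length (s0 y)) < N"
    and ne: "s x \<noteq> [] \<or> s y \<noteq> []"
  shows "wp N (add_step x y) (\<lambda>s'. add_inv x y s0 s' \<and> s' x = tl (s x) \<and> s' y = tl (s y)) s"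
proof -
  define d where "d = dig (top0 (s x)) + dig (top0 (s y)) + dig (top0 (s 7))"
  have bits_x: "bits (s x)" using inv b unfolding add_inv_def by (metis bits_simps(3))
  have top: "top0 (s x) = 0 \<longleftrightarrow> s x = []" using bits_top0[OF bits_x] by (auto simp: nonblank_def)
  have len5: "length (s 5) \<le> max (length (s0 x)) (length (s0 y)) - length (s x)"
  proof -
    have "length (s 5) + length (s x) = length (s0 x)" using inv unfolding add_inv_def
      by (metis length_append length_rev)
    then show ?thesis by simp
  qed
  have len6: "length (s 6) + max (length (s x)) (length (s y)) = max (length (s0 x)) (length (s0 y))"
    using inv by (simp add: add_inv_def)
  have pos: "0 < max (length (s x)) (length (s y))" using ne by (auto simp: less_max_iff_disj)
  have lt: "length (s 5) < N" "length (s 6) < N" using len5 len6 N by auto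
  have len: "Suc (length (s 6)) + max (length (tl (s x))) (length (tl (s y))) =
      max (length (s0 x)) (length (s0 y))"
    using len6 pos by auto
  \<comment> \<open>Two digits and a carry add up to at most 3, so the parity is the new digit and
    the test \<open>2 \<le> d\<close> the new carry.\<close>
  have d: "d = (if odd d then 1 else 0) + 2 * (if 2 \<le> d then 1 else 0)"
    unfolding d_def dig_def by auto
  have val: "bits_val (rev (s 6) @ [if odd d then 2 else 1]) + 2 ^ Suc (length (s 6)) *
      (bits_val (tl (s x)) + bits_val (tl (s y)) + (if 2 \<le> d then 1 else 0)) = bits_val (s0 x) + bits_val (s0 y)"
  proof -
    have "bits_val (s x) + bits_val (s y) + dig (top0 (s 7)) = d + 2 * (bits_val (tl (s x)) + bits_val (tl (s y)))"
      using bits_val_tl[of "s x"] bits_val_tl[of "s y"] by (simp add: d_def)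
    moreover have "bits_val (rev (s 6)) + 2 ^ length (s 6) * (bits_val (s x) + bits_val (s y) + dig (top0 (s 7)))
       = bits_val (s0 x) + bits_val (s0 y)" using inv by (simp add: add_inv_def)
    ultimately show ?thesis
      by (subst (asm) d) (simp add: bits_val_append algebra_simps split: if_splits)
  qed
  have c7: "tl (s 7) = []" "s 7 \<in> {[], [2]}" using inv by (auto simp: add_inv_def)
  have keep: "rev (s 5) @ s x = s0 x" using inv by (simp add: add_inv_def)
  have bb: "bits (s y)" "bits (s 6)" using inv by (simp_all add: add_inv_def)
  have fr: "\<forall>k. k \<notin> {5, 6, 7, x, y} \<longrightarrow> s k = s0 k" using inv by (simp add: add_inv_def)
  have keep': "rev (if s x = [] then s 5 else top0 (s x) # s 5) @ tl (s x) = s0 x"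
    using keep by (cases "s x") auto
  define R where "R s' \<longleftrightarrow> add_inv x y s0 s' \<and> s' x = tl (s x) \<and> s' y = tl (s y)" for s'
  have R: "R s'"
    if "s' x = tl (s x)" "s' y = tl (s y)" "s' 7 = (if 2 \<le> d then [2] else [])"
      "s' 5 = (if s x = [] then s 5 else top0 (s x) # s 5)" "s' 6 = (if odd d then 2 else 1) # s 6"
      "\<And>k. k \<noteq> 5 \<Longrightarrow> k \<noteq> 6 \<Longrightarrow> k \<noteq> 7 \<Longrightarrow> k \<noteq> x \<Longrightarrow> k \<noteq> y \<Longrightarrow> s' k = s k" for s'
  proof -
    have "rev (s' 5) @ s' x = s0 x" using keep' that by simp
    moreover have "bits (s' y)" "bits (s' 6)" using bb that by (auto simp: bits_tl)
    moreover have "s' 7 \<in> {[], [2]}" using that by simp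
    moreover have "bits_val (rev (s' 6)) + 2 ^ length (s' 6) * (bits_val (s' x) + bits_val (s' y) + dig (top0 (s' 7)))
       = bits_val (s0 x) + bits_val (s0 y)"
      using val that(1-3,5) by (cases "2 \<le> d") simp_all
    moreover have "length (s' 6) + max (length (s' x)) (length (s' y)) = max (length (s0 x)) (length (s0 y))"
      using len that by simp
    moreover have "\<forall>k. k \<notin> {5, 6, 7, x, y} \<longrightarrow> s' k = s0 k" using fr that(6) by simp
    ultimately show ?thesis using that(1,2) unfolding R_def add_inv_def by blast
  qed
  have xy': "5 \<noteq> x" "6 \<noteq> x" "7 \<noteq> x" "5 \<noteq> y" "6 \<noteq> y" "7 \<noteq> y" "y \<noteq> x"
    "x \<noteq> 5" "x \<noteq> 6" "x \<noteq> 7" "y \<noteq> 5" "y \<noteq> 6" "y \<noteq> 7" "x \<noteq> y" using xy by auto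
  have "wp N (add_step x y) R s"
    unfolding add_step_def wp_Case d_def[symmetric]
    using lt by (cases "s x = []"; cases "2 \<le> d") (auto simp: top c7(1) xy' intro!: R)
  then show ?thesis unfolding R_def .
qed

lemma wp_add_to:
  assumes xy: "x \<noteq> y" "x \<notin> {5, 6, 7}" "y \<notin> {5, 6, 7}"
    and b: "bits (s x)" "bits (s y)" and e: "s 5 = []" "s 6 = []" "s 7 = []"
    and N: "max (length (s x)) (length (s y)) < N"
    and Q: "\<And>zs. bits zs \<Longrightarrow> bits_val zs = bits_val (s x) + bits_val (s y) \<Longrightarrow>
      length zs \<le> Suc (max (length (s x)) (length (s y))) \<Longrightarrow> Q (s(y := zs))"
  shows "wp N (add_to x y) Q s"
proof -
  have bits_x: "bits (s' x)" if "add_inv x y s s'" for s'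
    using that b(1) unfolding add_inv_def by (metis bits_simps(3))
  have bits_y: "bits (s' y)" if "add_inv x y s s'" for s'
    using that by (simp add: add_inv_def)
  have fin: "wp N (Case 7 (\<lambda>c. if c = 0 then Skip else Pop 7 ;; Push 6 2) ;; move 5 x ;; move 6 y) Q s'"
    if inv: "add_inv x y s s'" and nil: "s' x = []" "s' y = []" for s'
  proof -
    define zs where "zs = rev (s' 6) @ (if s' 7 = [] then [] else [2])"
    have i: "rev (s' 5) = s x" "bits (s' 6)" "s' 7 \<in> {[], [2]}"
      "bits_val (rev (s' 6)) + 2 ^ length (s' 6) * dig (top0 (s' 7)) = bits_val (s x) + bits_val (s y)"
      "length (s' 6) = max (length (s x)) (length (s y))" "\<forall>k. k \<notin> {5, 6, 7, x, y} \<longrightarrow> s' k = s k"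
      using inv nil by (auto simp: add_inv_def)
    have "Q (s(y := zs))"
    proof (rule Q)
      show "bits zs" using i(2) by (simp add: zs_def)
      show "bits_val zs = bits_val (s x) + bits_val (s y)" using i(3,4) by (auto simp: zs_def bits_val_append)
      show "length zs \<le> Suc (max (length (s x)) (length (s y)))" using i(5) by (simp add: zs_def)
    qed
    then have Q': "Q (s2(5 := [], x := rev (s2 5) @ s2 x, 6 := [], y := rev (rev zs) @ s2 y))"
      if "s2 = s'(7 := [], 6 := rev zs)" for s2
    proof -
      have "s2(5 := [], x := rev (s2 5) @ s2 x, 6 := [], y := rev (rev zs) @ s2 y) = s(y := zs)"
        using i(1,6) e xy nil by (auto simp: fun_eq_iff that)
      with \<open>Q (s(y := zs))\<close> show ?thesis by (simp only:)
    qed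
    have z: "0 \<notin> set (s' 5)" using i(1) b(1) bits_zero_notin by (metis set_rev)
    have z': "0 \<notin> set zs" using i(2) by (auto simp: zs_def dest: bits_zero_notin)
    have l: "length (s' 5) = length (s x)" using i(1) by (metis length_rev)
    have l': "length zs \<le> N" "length (s' 6) < N"
      using N unfolding i(5)[symmetric] by (auto simp: zs_def)
    have mv: "wp N (move 5 x ;; move 6 y) Q (s'(7 := [], 6 := rev zs))"
      unfolding wp_Seq
    proof (rule wp_move)
      show "wp N (move 6 y) Q ((s'(7 := [], 6 := rev zs))(5 := [],
          x := rev ((s'(7 := [], 6 := rev zs)) 5) @ (s'(7 := [], 6 := rev zs)) x))"
        by (rule wp_move) (use Q'[OF refl] xy z' l' nil in auto)
    qed (use xy z l N nil in auto)
    consider "s' 7 = []" | "s' 7 = [2]" using i(3) by auto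
    then show ?thesis
    proof cases
      case 1
      then have "s'(7 := [], 6 := rev zs) = s'" by (auto simp: zs_def fun_eq_iff)
      with mv 1 show ?thesis by simp
    next
      case 2
      then have "s'(7 := [], 6 := rev zs) = s'(7 := [], 6 := 2 # s' 6)" by (auto simp: zs_def)
      with mv 2 l' show ?thesis by simp
    qed
  qed
  have "add_inv x y s s" using b e by (simp add: add_inv_def)
  then show ?thesis
    unfolding add_to_def wp_Seq[of N "While x nonblank (add_step x y)"]
  proof (rule wp_While_inv[where I = "add_inv x y s"])
    fix s1 assume 1: "add_inv x y s s1" "nonblank (top0 (s1 x))"
    then have "s1 x \<noteq> []" by auto
    then show "wp N (add_step x y) (\<lambda>s'. add_inv x y s s' \<and> length (s' x) < length (s1 x)) s1"
      by (intro wp_mono[OF wp_add_step[OF 1(1) xy b(1) N]]) auto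
  next
    fix s1 assume 1: "add_inv x y s s1" "\<not> nonblank (top0 (s1 x))"
    then have "add_inv x y s s1 \<and> s1 x = []" using bits_x bits_top0 by blast
    then show "wp N (While y nonblank (add_step x y) ;; Case 7 (\<lambda>c. if c = 0 then Skip else Pop 7 ;; Push 6 2) ;;
        move 5 x ;; move 6 y) Q s1"
      unfolding wp_Seq[of N "While y nonblank (add_step x y)"]
    proof (rule wp_While_inv[where I = "\<lambda>s'. add_inv x y s s' \<and> s' x = []"])
      fix s2 assume 2: "add_inv x y s s2 \<and> s2 x = []" "nonblank (top0 (s2 y))"
      then have "s2 y \<noteq> []" by auto
      then show "wp N (add_step x y)
          (\<lambda>s'. (add_inv x y s s' \<and> s' x = []) \<and> length (s' y) < length (s2 y)) s2"
        using 2 by (intro wp_mono[OF wp_add_step[OF conjunct1[OF 2(1)] xy b(1) N]]) auto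
    next
      fix s2 assume 2: "add_inv x y s s2 \<and> s2 x = []" "\<not> nonblank (top0 (s2 y))"
      then have "s2 y = []" using bits_y bits_top0 by blast
      with 2 show "wp N (Case 7 (\<lambda>c. if c = 0 then Skip else Pop 7 ;; Push 6 2) ;; move 5 x ;; move 6 y) Q s2"
        using fin by blast
    qed
  qed
qed

text \<open>Coefficients are read most significant digit first, so a product with a number on a stack is
  accumulated by Horner's rule while reading.\<close>

definition number_loop :: com where
  "number_loop = While 4 is_bit (Case 4 (\<lambda>a. Pop 4 ;; Push 10 1 ;; (if a = 2 then add_to 9 10 else Skip)))"

text \<open>Pushing the code 1 of the digit 0 onto the least significant end doubles stack 10, and a
  digit 1 adds stack 9. A digit read lengthens the result by at most two, one for the doubling and
  one for the carry; this is the origin of \<open>2 * length w\<close>.\<close>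

lemma wp_number_loop:
  assumes "s 4 = w @ c # rest" "bits w" "\<not> is_bit c" "bits (s 9)" "bits (s 10)"
    and "s 5 = []" "s 6 = []" "s 7 = []"
    and "max (length (s 9)) (length (s 10)) + 2 * length w < N"
    and "\<And>zs. bits zs \<Longrightarrow> bits_val zs = 2 ^ length w * bits_val (s 10) + bits_val (rev w) * bits_val (s 9) \<Longrightarrow>
      length zs \<le> max (length (s 9)) (length (s 10)) + 2 * length w \<Longrightarrow> Q (s(4 := c # rest, 10 := zs))"
  shows "wp N number_loop Q s"
  using assms
proof (induction w arbitrary: s)
  case Nil
  have eq: "s(4 := c # rest, 10 := s 10) = s" using Nil.prems(1) by (auto simp: fun_eq_iff)
  have "Q (s(4 := c # rest, 10 := s 10))" using Nil.prems(5) by (intro Nil.prems(10)) auto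
  then have "Q s" by (simp only: eq)
  then show ?case unfolding number_loop_def using Nil.prems by (intro wp_While_False) auto
next
  case (Cons a w)
  let ?m = "max (length (s 9)) (length (s 10))"
  have step: "wp N number_loop Q (s(4 := w @ c # rest, 10 := zs))"
    if zs: "bits zs" "bits_val zs = 2 * bits_val (s 10) + dig a * bits_val (s 9)" "length zs \<le> ?m + 2" for zs
  proof (rule Cons.IH)
    fix zs'
    assume z: "bits zs'" "bits_val zs' = 2 ^ length w * bits_val ((s(4 := w @ c # rest, 10 := zs)) 10) +
        bits_val (rev w) * bits_val ((s(4 := w @ c # rest, 10 := zs)) 9)"
      "length zs' \<le> max (length ((s(4 := w @ c # rest, 10 := zs)) 9)) (length ((s(4 := w @ c # rest, 10 := zs)) 10)) + 2 * length w"
    have "Q (s(4 := c # rest, 10 := zs'))"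
      using z zs by (intro Cons.prems(10)) (auto simp: bits_val_append algebra_simps)
    then show "Q ((s(4 := w @ c # rest, 10 := zs))(4 := c # rest, 10 := zs'))"
      by (simp add: fun_upd_twist)
  qed (use Cons.prems zs in auto)
  have "is_bit a" using Cons.prems(2) by simp
  then have a: "a = 1 \<or> a = 2" by (simp add: is_bit_def)
  show ?case
    unfolding number_loop_def
  proof (rule wp_While_True, use Cons.prems a in force, fold number_loop_def)
    let ?R = "\<lambda>s'. length (s' 4) < length (s 4) \<and> wp N number_loop Q s'"
    let ?s = "s(4 := w @ c # rest, 10 := 1 # s 10)"
    have "wp N (if a = 2 then add_to 9 10 else Skip) ?R ?s"
    proof (cases "a = 2")
      case True
      have "wp N (add_to 9 10) ?R ?s"
      proof (rule wp_add_to)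
        fix zs assume "bits zs" "bits_val zs = bits_val (?s 9) + bits_val (?s 10)"
          "length zs \<le> Suc (max (length (?s 9)) (length (?s 10)))"
        then have "wp N number_loop Q (s(4 := w @ c # rest, 10 := zs))"
          using True by (intro step) auto
        then show "?R (?s(10 := zs))" using Cons.prems(1) by simp
      qed (use Cons.prems in auto)
      then show ?thesis using True by simp
    next
      case False
      then have "wp N number_loop Q ?s"
        using a Cons.prems(5) by (intro step) auto
      then show ?thesis using False Cons.prems(1) by simp
    qed
    then show "wp N (Case 4 (\<lambda>a. Pop 4 ;; Push 10 1 ;; (if a = 2 then add_to 9 10 else Skip))) ?R s"
      using Cons.prems(1,9) by (cases "a = 2") auto
  qed
qed

text \<open>The denominator b of a weight multiplies both \<open>A\<close> and \<open>B\<close> but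
  can be read only once, so the two products are accumulated together: b B on stack 11 and b A on
  stack 12.\<close>

definition number_loop2 :: com where
  "number_loop2 = While 4 is_bit (Case 4 (\<lambda>a. Pop 4 ;; Push 11 1 ;; Push 12 1 ;;
     (if a = 2 then add_to 9 11 ;; add_to 8 12 else Skip)))"

lemma wp_number_loop2:
  assumes "s 4 = w @ c # rest" "bits w" "\<not> is_bit c" "bits (s 8)" "bits (s 9)" "bits (s 11)" "bits (s 12)"
    and "s 5 = []" "s 6 = []" "s 7 = []"
    and "max (length (s 9)) (length (s 11)) + 2 * length w < N"
    and "max (length (s 8)) (length (s 12)) + 2 * length w < N"
    and "\<And>ys zs. bits ys \<Longrightarrow> bits zs \<Longrightarrow>
      bits_val ys = 2 ^ length w * bits_val (s 11) + bits_val (rev w) * bits_val (s 9) \<Longrightarrow>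
      bits_val zs = 2 ^ length w * bits_val (s 12) + bits_val (rev w) * bits_val (s 8) \<Longrightarrow>
      length ys \<le> max (length (s 9)) (length (s 11)) + 2 * length w \<Longrightarrow>
      length zs \<le> max (length (s 8)) (length (s 12)) + 2 * length w \<Longrightarrow> Q (s(4 := c # rest, 11 := ys, 12 := zs))"
  shows "wp N number_loop2 Q s"
  using assms
proof (induction w arbitrary: s)
  case Nil
  have eq: "s(4 := c # rest, 11 := s 11, 12 := s 12) = s" using Nil.prems(1) by (auto simp: fun_eq_iff)
  have "Q (s(4 := c # rest, 11 := s 11, 12 := s 12))" using Nil.prems(6,7) by (intro Nil.prems(13)) auto
  then have "Q s" by (simp only: eq)
  then show ?case unfolding number_loop2_def using Nil.prems by (intro wp_While_False) auto
next
  case (Cons a w)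
  let ?m = "max (length (s 9)) (length (s 11))" and ?m' = "max (length (s 8)) (length (s 12))"
  have step: "wp N number_loop2 Q (s(4 := w @ c # rest, 11 := ys, 12 := zs))"
    if zs: "bits ys" "bits zs" "bits_val ys = 2 * bits_val (s 11) + dig a * bits_val (s 9)"
      "bits_val zs = 2 * bits_val (s 12) + dig a * bits_val (s 8)"
      "length ys \<le> ?m + 2" "length zs \<le> ?m' + 2" for ys zs
  proof (rule Cons.IH)
    let ?s = "s(4 := w @ c # rest, 11 := ys, 12 := zs)"
    fix ys' zs'
    assume z: "bits ys'" "bits zs'"
      "bits_val ys' = 2 ^ length w * bits_val (?s 11) + bits_val (rev w) * bits_val (?s 9)"
      "bits_val zs' = 2 ^ length w * bits_val (?s 12) + bits_val (rev w) * bits_val (?s 8)"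
      "length ys' \<le> max (length (?s 9)) (length (?s 11)) + 2 * length w"
      "length zs' \<le> max (length (?s 8)) (length (?s 12)) + 2 * length w"
    have "Q (s(4 := c # rest, 11 := ys', 12 := zs'))"
      using z zs by (intro Cons.prems(13)) (auto simp: bits_val_append algebra_simps)
    then show "Q (?s(4 := c # rest, 11 := ys', 12 := zs'))"
      by (simp add: fun_upd_twist)
  qed (use Cons.prems zs in auto)
  have "is_bit a" using Cons.prems(2) by simp
  then have a: "a = 1 \<or> a = 2" by (simp add: is_bit_def)
  show ?case
    unfolding number_loop2_def
  proof (rule wp_While_True, use Cons.prems a in force, fold number_loop2_def)
    let ?R = "\<lambda>s'. length (s' 4) < length (s 4) \<and> wp N number_loop2 Q s'"
    let ?s = "s(4 := w @ c # rest, 11 := 1 # s 11, 12 := 1 # s 12)"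
    have "wp N (if a = 2 then add_to 9 11 ;; add_to 8 12 else Skip) ?R ?s"
    proof (cases "a = 2")
      case True
      have "wp N (add_to 9 11) (wp N (add_to 8 12) ?R) ?s"
      proof (rule wp_add_to)
        fix ys assume y: "bits ys" "bits_val ys = bits_val (?s 9) + bits_val (?s 11)"
          "length ys \<le> Suc (max (length (?s 9)) (length (?s 11)))"
        show "wp N (add_to 8 12) ?R (?s(11 := ys))"
        proof (rule wp_add_to)
          fix zs assume z: "bits zs" "bits_val zs = bits_val ((?s(11 := ys)) 8) + bits_val ((?s(11 := ys)) 12)"
            "length zs \<le> Suc (max (length ((?s(11 := ys)) 8)) (length ((?s(11 := ys)) 12)))"
          then have "wp N number_loop2 Q (s(4 := w @ c # rest, 11 := ys, 12 := zs))"
            using True y by (intro step) auto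
          moreover have "?s(11 := ys, 12 := zs) = s(4 := w @ c # rest, 11 := ys, 12 := zs)"
            by (auto simp: fun_eq_iff)
          ultimately show "?R (?s(11 := ys, 12 := zs))" using Cons.prems(1) by simp
        qed (use Cons.prems in auto)
      qed (use Cons.prems in auto)
      then show ?thesis using True by simp
    next
      case False
      then have "wp N number_loop2 Q ?s"
        using a Cons.prems(6,7) by (intro step) auto
      then show ?thesis using False Cons.prems(1) by simp
    qed
    then show "wp N (Case 4 (\<lambda>a. Pop 4 ;; Push 11 1 ;; Push 12 1 ;;
        (if a = 2 then add_to 9 11 ;; add_to 8 12 else Skip))) ?R s"
      using Cons.prems(1,11,12) by (cases "a = 2") auto
  qed
qed

text \<open>For a weight a/b the stacks 10 and 11 end up with a B + b A and b B, while
  \<open>A\<close> and \<open>B\<close> survive on 8 and 9 in case the term is not to be counted.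
  The two pops skip the slash and the opening parenthesis.\<close>

definition read_coefficient :: com where
  "read_coefficient = number_loop ;; Pop 4 ;; number_loop2 ;; Pop 4 ;; add_to 12 10 ;; clear 12"

lemma wp_read_coefficient:
  assumes "s 4 = wa @ 3 # wb @ 6 # rest" "bits wa" "bits wb" "bits (s 8)" "bits (s 9)"
    and e: "s 5 = []" "s 6 = []" "s 7 = []" "s 10 = []" "s 11 = []" "s 12 = []"
    and "max (length (s 8)) (length (s 9)) + 2 * (length wa + length wb) < N"
    and Q: "\<And>xs ys. bits xs \<Longrightarrow> bits ys \<Longrightarrow>
      bits_val xs = bits_val (rev wa) * bits_val (s 9) + bits_val (rev wb) * bits_val (s 8) \<Longrightarrow>
      bits_val ys = bits_val (rev wb) * bits_val (s 9) \<Longrightarrow>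
      length xs \<le> max (length (s 8)) (length (s 9)) + 2 * (length wa + length wb) + 1 \<Longrightarrow>
      length ys \<le> max (length (s 8)) (length (s 9)) + 2 * (length wa + length wb) + 1 \<Longrightarrow>
      Q (s(4 := rest, 10 := xs, 11 := ys))"
  shows "wp N read_coefficient Q s"
  unfolding read_coefficient_def wp_Seq
proof (rule wp_number_loop)
  fix zs1 assume z1: "bits zs1" "bits_val zs1 = 2 ^ length wa * bits_val (s 10) + bits_val (rev wa) * bits_val (s 9)"
    "length zs1 \<le> max (length (s 9)) (length (s 10)) + 2 * length wa"
  let ?s1 = "s(4 := wb @ 6 # rest, 10 := zs1)"
  have "wp N number_loop2 (wp N (Pop 4) (wp N (add_to 12 10) (wp N (clear 12) Q))) ?s1"
  proof (rule wp_number_loop2)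
    fix ys zs assume z2: "bits ys" "bits zs"
      "bits_val ys = 2 ^ length wb * bits_val (?s1 11) + bits_val (rev wb) * bits_val (?s1 9)"
      "bits_val zs = 2 ^ length wb * bits_val (?s1 12) + bits_val (rev wb) * bits_val (?s1 8)"
      "length ys \<le> max (length (?s1 9)) (length (?s1 11)) + 2 * length wb"
      "length zs \<le> max (length (?s1 8)) (length (?s1 12)) + 2 * length wb"
    let ?s2 = "s(4 := rest, 10 := zs1, 11 := ys, 12 := zs)"
    have "wp N (add_to 12 10) (wp N (clear 12) Q) ?s2"
    proof (rule wp_add_to)
      fix xs assume x: "bits xs" "bits_val xs = bits_val (?s2 12) + bits_val (?s2 10)"
        "length xs \<le> Suc (max (length (?s2 12)) (length (?s2 10)))"
      show "wp N (clear 12) Q (?s2(10 := xs))"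
      proof (rule wp_clear)
        have "Q (s(4 := rest, 10 := xs, 11 := ys))"
          using z1 z2 x e by (intro Q) auto
        moreover have "?s2(10 := xs, 12 := []) = s(4 := rest, 10 := xs, 11 := ys)"
          using e by (auto simp: fun_eq_iff)
        ultimately show "Q (?s2(10 := xs, 12 := []))" by simp
      qed (use z2 in \<open>auto dest: bits_zero_notin\<close>)
    qed (use z1 z2 e assms(12) in auto)
    moreover have "?s1(4 := 6 # rest, 11 := ys, 12 := zs, 4 := rest) = ?s2" by (auto simp: fun_eq_iff)
    ultimately show "wp N (Pop 4) (wp N (add_to 12 10) (wp N (clear 12) Q)) (?s1(4 := 6 # rest, 11 := ys, 12 := zs))"
      by simp
  qed (use assms z1 in \<open>auto simp: is_bit_def\<close>)
  moreover have "s(4 := 3 # wb @ 6 # rest, 10 := zs1, 4 := wb @ 6 # rest) = ?s1" by (auto simp: fun_eq_iff)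
  ultimately show "wp N (Pop 4) (wp N number_loop2 (wp N (Pop 4) (wp N (add_to 12 10) (wp N (clear 12) Q))))
      (s(4 := 3 # wb @ 6 # rest, 10 := zs1))"
    by simp
qed (use assms in \<open>auto simp: is_bit_def\<close>)

section \<open>Comparison of binary numbers\<close>

definition compare_step :: com where
  "compare_step = Case 8 (\<lambda>a. Case 9 (\<lambda>b. Pop 8 ;; Pop 9 ;;
     (if dig a = dig b then Skip else Pop 7 ;; (if dig a < dig b then Push 7 2 else Skip))))"

text \<open>\<open>A < B\<close> means that the weights covering the current variable sum up to less
  than 1; the answer flag on stack 15 is then withdrawn, for good, since nothing pushes it
  again.\<close>

definition compare :: com where
  "compare = While 8 nonblank compare_step ;; While 9 nonblank compare_step ;;
     Case 7 (\<lambda>c. if c = 0 then Skip else Pop 7 ;; Pop 15)"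

text \<open>Digits are read from the least significant end, so each later difference overrides the
  earlier ones. The flag on stack 7 decides only if the unread higher digits agree.\<close>

definition compare_inv :: "stacks \<Rightarrow> stacks \<Rightarrow> bool" where
  "compare_inv s0 s \<longleftrightarrow> (\<forall>k. k \<notin> {7, 8, 9} \<longrightarrow> s k = s0 k) \<and> bits (s 8) \<and> bits (s 9) \<and> s 7 \<in> {[], [2]} \<and>
     (bits_val (s0 8) < bits_val (s0 9) \<longleftrightarrow>
      bits_val (s 8) < bits_val (s 9) \<or> bits_val (s 8) = bits_val (s 9) \<and> s 7 \<noteq> [])"

lemma wp_compare_step:
  assumes inv: "compare_inv s0 s" and N: "0 < N"
  shows "wp N compare_step (\<lambda>s'. compare_inv s0 s' \<and> s' 8 = tl (s 8) \<and> s' 9 = tl (s 9)) s"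
proof -
  have b: "bits (tl (s 8))" "bits (tl (s 9))" and c: "s 7 \<in> {[], [2]}"
    using inv by (auto simp: compare_inv_def bits_tl)
  define a a' where "a = dig (top0 (s 8))" and "a' = dig (top0 (s 9))"
  have a: "a \<le> 1" "a' \<le> 1" by (simp_all add: a_def a'_def dig_def)
  have v: "bits_val (s 8) = a + 2 * bits_val (tl (s 8))" "bits_val (s 9) = a' + 2 * bits_val (tl (s 9))"
    unfolding a_def a'_def by (rule bits_val_tl)+
  have lt: "bits_val (s0 8) < bits_val (s0 9) \<longleftrightarrow>
      bits_val (s 8) < bits_val (s 9) \<or> bits_val (s 8) = bits_val (s 9) \<and> s 7 \<noteq> []"
    and fr: "\<forall>k. k \<notin> {7, 8, 9} \<longrightarrow> s k = s0 k"
    using inv by (simp_all add: compare_inv_def)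
  show ?thesis
    unfolding compare_step_def wp_Case a_def[symmetric] a'_def[symmetric]
    using b c N fr lt a unfolding v
    by (auto simp: compare_inv_def)
qed

lemma wp_compare:
  assumes b: "bits (s 8)" "bits (s 9)" and e: "s 7 = []" and N: "0 < N"
    and Q: "Q (s(8 := [], 9 := [], 15 := if bits_val (s 8) < bits_val (s 9) then tl (s 15) else s 15))"
  shows "wp N compare Q s"
proof -
  let ?last = "Case 7 (\<lambda>c. if c = 0 then Skip else Pop 7 ;; Pop 15)"
  have fin: "wp N ?last Q s'" if inv: "compare_inv s s'" and nil: "s' 8 = []" "s' 9 = []" for s'
  proof -
    have i: "s' 7 \<in> {[], [2]}" "bits_val (s 8) < bits_val (s 9) \<longleftrightarrow> s' 7 \<noteq> []"
      "\<forall>k. k \<notin> {7, 8, 9} \<longrightarrow> s' k = s k"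
      using inv nil by (auto simp: compare_inv_def)
    have "s'(7 := [], 15 := if s' 7 = [] then s' 15 else tl (s' 15)) =
        s(8 := [], 9 := [], 15 := if bits_val (s 8) < bits_val (s 9) then tl (s 15) else s 15)"
      using i nil e by (auto simp: fun_eq_iff)
    then have "Q (s'(7 := [], 15 := if s' 7 = [] then s' 15 else tl (s' 15)))" using Q by simp
    moreover have "s'(7 := [], 15 := s' 15) = s'" if "s' 7 = []" using that by (auto simp: fun_eq_iff)
    ultimately show ?thesis using i(1) by (cases "s' 7 = []") auto
  qed
  have "compare_inv s s" using b e by (simp add: compare_inv_def)
  then show ?thesis
    unfolding compare_def wp_Seq[of N "While 8 nonblank compare_step"]
  proof (rule wp_While_inv[where I = "compare_inv s"])
    fix s1 assume 1: "compare_inv s s1" "nonblank (top0 (s1 8))"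
    then have "s1 8 \<noteq> []" by auto
    then show "wp N compare_step (\<lambda>s'. compare_inv s s' \<and> length (s' 8) < length (s1 8)) s1"
      by (intro wp_mono[OF wp_compare_step[OF 1(1) N]]) auto
  next
    fix s1 assume 1: "compare_inv s s1" "\<not> nonblank (top0 (s1 8))"
    then have "compare_inv s s1 \<and> s1 8 = []" using bits_top0 by (auto simp: compare_inv_def)
    then show "wp N (While 9 nonblank compare_step ;; ?last) Q s1"
      unfolding wp_Seq[of N "While 9 nonblank compare_step"]
    proof (rule wp_While_inv[where I = "\<lambda>s'. compare_inv s s' \<and> s' 8 = []"])
      fix s2 assume 2: "compare_inv s s2 \<and> s2 8 = []" "nonblank (top0 (s2 9))"
      then have "s2 9 \<noteq> []" by auto
      then show "wp N compare_step (\<lambda>s'. (compare_inv s s' \<and> s' 8 = []) \<and> length (s' 9) < length (s2 9)) s2"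
        using 2 by (intro wp_mono[OF wp_compare_step[OF conjunct1[OF 2(1)] N]]) auto
    next
      fix s2 assume 2: "compare_inv s s2 \<and> s2 8 = []" "\<not> nonblank (top0 (s2 9))"
      then have "s2 9 = []" using bits_top0 by (auto simp: compare_inv_def)
      with 2 show "wp N ?last Q s2" using fin by blast
    qed
  qed
qed

section \<open>Reading one term of the inequality\<close>

text \<open>If the current variable is shorter than the word, stack 2 shows the blank, which differs
  from every bit and thus counts as a mismatch. The word is read to its end even after a
  mismatch.\<close>

definition match_loop :: com where
  "match_loop = While 4 is_bit (Case 4 (\<lambda>a. Case 2 (\<lambda>b.
     (if a = b then Skip else Pop 13) ;; Pop 4 ;; (if b = 0 then Skip else Pop 2 ;; Push 3 b))))"

lemma wp_match_loop:
  assumes "s 4 = w @ c # rest" "bits w" "\<not> is_bit c" "bits (s 2)" "length (s 13) \<le> 1"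
    and "length (s 2) + length (s 3) \<le> N"
    and "Q (s(2 := drop (length w) (s 2), 3 := rev (take (length w) (s 2)) @ s 3, 4 := c # rest,
           13 := if take (length w) (s 2) = w then s 13 else []))"
  shows "wp N match_loop Q s"
  using assms
proof (induction w arbitrary: s)
  case Nil
  have eq: "s(2 := drop (length []) (s 2), 3 := rev (take (length []) (s 2)) @ s 3, 4 := c # rest,
      13 := if take (length []) (s 2) = [] then s 13 else []) = s"
    using Nil.prems(1) by (auto simp: fun_eq_iff)
  have "Q s" using Nil.prems(7) by (simp only: eq)
  then show ?case unfolding match_loop_def using Nil.prems by (intro wp_While_False) auto
next
  case (Cons a w)
  have a: "is_bit a" "a \<noteq> 0" using Cons.prems(2) by (auto simp: is_bit_def)
  show ?case
  proof (cases "s 2")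
    case Nil
    let ?s = "s(4 := w @ c # rest, 13 := [])"
    have "wp N match_loop Q ?s"
    proof (rule Cons.IH)
      have "?s(2 := drop (length w) (?s 2), 3 := rev (take (length w) (?s 2)) @ ?s 3, 4 := c # rest,
           13 := if take (length w) (?s 2) = w then ?s 13 else []) =
         s(2 := drop (length (a # w)) (s 2), 3 := rev (take (length (a # w)) (s 2)) @ s 3, 4 := c # rest,
           13 := if take (length (a # w)) (s 2) = a # w then s 13 else [])"
        using Nil by (auto simp: fun_eq_iff)
      then show "Q (?s(2 := drop (length w) (?s 2), 3 := rev (take (length w) (?s 2)) @ ?s 3, 4 := c # rest,
           13 := if take (length w) (?s 2) = w then ?s 13 else []))"
        using Cons.prems(7) by (simp only:)
    qed (use Cons.prems Nil in auto)
    moreover have "tl (s 13) = []" using Cons.prems(5) by (cases "s 13") auto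
    moreover have "s(13 := [], 4 := w @ c # rest) = ?s" by (auto simp: fun_eq_iff)
    ultimately show ?thesis
      unfolding match_loop_def using Cons.prems(1) a Nil by (intro wp_While_True) auto
  next
    case (Cons b x)
    have b: "b \<noteq> 0" using Cons.prems(4) Cons by (auto simp: is_bit_def)
    let ?s = "s(2 := x, 3 := b # s 3, 4 := w @ c # rest, 13 := if a = b then s 13 else [])"
    have "wp N match_loop Q ?s"
    proof (rule Cons.IH)
      have "?s(2 := drop (length w) (?s 2), 3 := rev (take (length w) (?s 2)) @ ?s 3, 4 := c # rest,
           13 := if take (length w) (?s 2) = w then ?s 13 else []) =
         s(2 := drop (length (a # w)) (s 2), 3 := rev (take (length (a # w)) (s 2)) @ s 3, 4 := c # rest,
           13 := if take (length (a # w)) (s 2) = a # w then s 13 else [])"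
        using Cons by (auto simp: fun_eq_iff)
      then show "Q (?s(2 := drop (length w) (?s 2), 3 := rev (take (length w) (?s 2)) @ ?s 3, 4 := c # rest,
           13 := if take (length w) (?s 2) = w then ?s 13 else []))"
        using Cons.prems(7) by (simp only:)
    qed (use Cons.prems Cons in auto)
    moreover have "tl (s 13) = []" using Cons.prems(5) by (cases "s 13") auto
    moreover have "s(13 := [], 4 := w @ c # rest, 2 := x, 3 := b # s 3) = ?s" if "a \<noteq> b"
      using that by (auto simp: fun_eq_iff)
    moreover have "s(4 := w @ c # rest, 2 := x, 3 := b # s 3) = ?s" if "a = b"
      using that by (auto simp: fun_eq_iff)
    ultimately show ?thesis
      unfolding match_loop_def using Cons.prems(1,6) a b Cons by (intro wp_While_True) auto
  qed
qed

text \<open>The loop establishes only that the word is a prefix of the variable; a nonempty rest on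
  stack 2 must therefore also revoke the flag. Afterwards the variable is rebuilt from stack
  3.\<close>

definition match_word :: "com \<Rightarrow> com" where
  "match_word act = Push 13 1 ;; match_loop ;; Pop 4 ;;
     Case 2 (\<lambda>b. if b = 0 then Skip else Pop 13) ;; move 3 2 ;;
     Case 13 (\<lambda>e. if e = 0 then Skip else Pop 13 ;; act)"

lemma wp_match_word:
  assumes s4: "s 4 = w @ 4 # rest" and w: "bits w" and x: "bits (s 2)" and e: "s 3 = []" "s 13 = []"
    and N: "0 < N" "length (s 2) \<le> N"
    and Q: "if w = s 2 then wp N act Q (s(4 := rest)) else Q (s(4 := rest))"
  shows "wp N (match_word act) Q s"
  unfolding match_word_def wp_Seq
proof (simp add: e N, rule wp_match_loop)
  let ?n = "length w"
  let ?x = "s 2"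
  define e1 where "e1 = (if take ?n ?x = w then [1] else [] :: nat list)"
  define e2 where "e2 = (if w = ?x then [1] else [] :: nat list)"
  have e12: "(if drop ?n ?x = [] then e1 else tl e1) = e2"
  proof -
    have "drop ?n ?x = [] \<longleftrightarrow> length ?x \<le> ?n" by simp
    then show ?thesis by (auto simp: e1_def e2_def)
  qed
  let ?s1 = "s(2 := drop ?n ?x, 3 := rev (take ?n ?x), 4 := rest, 13 := e1)"
  have "bits (drop ?n ?x)" "bits (take ?n ?x)" using x by (auto simp: bits_def dest: in_set_dropD in_set_takeD)
  then have top: "top0 (drop ?n ?x) = 0 \<longleftrightarrow> drop ?n ?x = []" and z: "0 \<notin> set (take ?n ?x)"
    using bits_top0[of "drop ?n ?x"] bits_zero_notin by (auto simp: nonblank_def)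
  let ?fin = "Case 13 (\<lambda>e. if e = 0 then Skip else Pop 13 ;; act)"
  have fin: "wp N ?fin Q (s(4 := rest, 13 := e2))"
  proof (cases "w = ?x")
    case True
    have "s(4 := rest, 13 := []) = s(4 := rest)" using e by (auto simp: fun_eq_iff)
    then show ?thesis using Q True by (simp add: e2_def)
  next
    case False
    have "s(4 := rest, 13 := []) = s(4 := rest)" using e by (auto simp: fun_eq_iff)
    then show ?thesis using Q False e by (simp add: e2_def)
  qed
  have mv: "wp N (move 3 2) (wp N ?fin Q) (s(2 := drop ?n ?x, 3 := rev (take ?n ?x), 4 := rest, 13 := e2))"
  proof (rule wp_move)
    let ?s2 = "s(2 := drop ?n ?x, 3 := rev (take ?n ?x), 4 := rest, 13 := e2)"
    have "?s2(3 := [], 2 := rev (?s2 3) @ ?s2 2) = s(4 := rest, 13 := e2)"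
      using e by (auto simp: fun_eq_iff)
    then show "wp N ?fin Q (?s2(3 := [], 2 := rev (?s2 3) @ ?s2 2))" using fin by (simp only:)
  qed (use z N in \<open>auto\<close>)
  have cs: "wp N (Case 2 (\<lambda>b. if b = 0 then Skip else Pop 13)) (wp N (move 3 2) (wp N ?fin Q)) ?s1"
    using mv e12 top by (cases "drop ?n ?x = []") auto
  let ?s0 = "s(13 := [Suc 0])"
  have "?s0(2 := drop (length w) (?s0 2), 3 := rev (take (length w) (?s0 2)) @ ?s0 3, 4 := 4 # rest,
      13 := if take (length w) (?s0 2) = w then ?s0 13 else [], 4 := rest) = ?s1"
    using e by (auto simp: fun_eq_iff e1_def)
  with cs show "wp N (Pop 4) (wp N (Case 2 (\<lambda>b. if b = 0 then Skip else Pop 13)) (wp N (move 3 2) (wp N ?fin Q)))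
    (?s0(2 := drop (length w) (?s0 2), 3 := rev (take (length w) (?s0 2)) @ ?s0 3, 4 := 4 # rest,
      13 := if take (length w) (?s0 2) = w then ?s0 13 else []))"
    unfolding wp_Pop by simp
qed (use assms in \<open>auto simp: is_bit_def\<close>)

definition scan_words :: "com \<Rightarrow> com" where
  "scan_words act = While 4 is_bit (match_word act)"

abbreviation words_code :: "nat list list \<Rightarrow> nat list" where
  "words_code ws \<equiv> concat (map (\<lambda>w. w @ [4]) ws)"

text \<open>The action assigns the fixed value \<open>v\<close> to stack 14 whatever was there, so
  after the whole list it only matters whether some word matched. Nonempty words ensure that the
  next one is recognised by a bit on top.\<close>

lemma wp_scan_words:
  assumes "s 4 = words_code ws @ c # rest" "\<forall>w\<in>set ws. bits w \<and> w \<noteq> []" "\<not> is_bit c"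
    and "bits (s 2)" "s 3 = []" "s 13 = []" "0 < N" "length (s 2) \<le> N" "length (s 14) \<le> 1"
    and act: "\<And>s Q. length (s 14) \<le> 1 \<Longrightarrow> Q (s(14 := v)) \<Longrightarrow> wp N act Q s" and v: "length v \<le> 1"
    and "Q (s(4 := c # rest, 14 := if s 2 \<in> set ws then v else s 14))"
  shows "wp N (scan_words act) Q s"
  using assms(1-9,12)
proof (induction ws arbitrary: s)
  case Nil
  have eq: "s(4 := c # rest, 14 := if s 2 \<in> set [] then v else s 14) = s"
    using Nil.prems(1) by (auto simp: fun_eq_iff)
  have "Q s" using Nil.prems(10) by (simp only: eq)
  then show ?case unfolding scan_words_def using Nil.prems by (intro wp_While_False) auto
next
  case (Cons w ws)
  let ?r = "words_code ws @ c # rest"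
  have s4: "s 4 = w @ 4 # ?r" using Cons.prems(1) by simp
  have w: "bits w" "w \<noteq> []" using Cons.prems(2) by auto
  have "wp N (scan_words act) Q (s(4 := ?r, 14 := if w = s 2 then v else s 14))"
  proof (rule Cons.IH)
    let ?s = "s(4 := ?r, 14 := if w = s 2 then v else s 14)"
    have "?s(4 := c # rest, 14 := if ?s 2 \<in> set ws then v else ?s 14) =
        s(4 := c # rest, 14 := if s 2 \<in> set (w # ws) then v else s 14)"
      by (auto simp: fun_eq_iff)
    then show "Q (?s(4 := c # rest, 14 := if ?s 2 \<in> set ws then v else ?s 14))"
      using Cons.prems(10) by (simp only:)
  qed (use Cons.prems v in auto)
  then have rec: "wp N (scan_words act) Q (if w = s 2 then s(4 := ?r, 14 := v) else s(4 := ?r))"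
    by (cases "w = s 2") (simp_all add: fun_upd_idem)
  let ?R = "\<lambda>s'. length (s' 4) < length (s 4) \<and> wp N (scan_words act) Q s'"
  have "wp N (match_word act) ?R s"
  proof (rule wp_match_word[OF _ w(1), where rest = ?r])
    show "if w = s 2 then wp N act ?R (s(4 := ?r)) else ?R (s(4 := ?r))"
    proof (cases "w = s 2")
      case True
      have "?R (s(4 := ?r, 14 := v))" using rec True s4 by simp
      then have "wp N act ?R (s(4 := ?r))" using Cons.prems(9) by (intro act) simp_all
      with True show ?thesis by simp
    next
      case False
      then show ?thesis using rec s4 by simp
    qed
  qed (use Cons.prems s4 in simp_all)
  moreover have "is_bit (top0 (s 4))" using s4 w by (cases w) auto
  ultimately show ?case unfolding scan_words_def by (intro wp_While_True) auto
qed

text \<open>Membership in V raises the flag on stack 14 and membership in U lowers it again, in the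
  order of the encoding; what remains is membership in V - U. Popping before pushing keeps the flag
  at height at most 1.\<close>

definition read_conditional :: com where
  "read_conditional = scan_words (Pop 14 ;; Push 14 1) ;; Pop 4 ;; scan_words (Pop 14) ;; Pop 4"

lemma wp_read_conditional:
  assumes "s 4 = words_code vs @ 5 # words_code us @ 7 # rest"
    "\<forall>w\<in>set vs. bits w \<and> w \<noteq> []" "\<forall>w\<in>set us. bits w \<and> w \<noteq> []"
    and "bits (s 2)" "s 3 = []" "s 13 = []" "s 14 = []" "0 < N" "length (s 2) \<le> N"
    and Q: "Q (s(4 := rest, 14 := if s 2 \<in> set vs - set us then [1] else []))"
  shows "wp N read_conditional Q s"
  unfolding read_conditional_def wp_Seq
proof (rule wp_scan_words)
  let ?s1 = "s(4 := 5 # words_code us @ 7 # rest, 14 := if s 2 \<in> set vs then [1] else s 14)"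
  let ?s2 = "s(4 := words_code us @ 7 # rest, 14 := if s 2 \<in> set vs then [1] else [])"
  have "wp N (scan_words (Pop 14)) (wp N (Pop 4) Q) ?s2"
  proof (rule wp_scan_words)
    have "?s2(4 := 7 # rest, 14 := if ?s2 2 \<in> set us then [] else ?s2 14, 4 := rest) =
        s(4 := rest, 14 := if s 2 \<in> set vs - set us then [1] else [])"
      by (auto simp: fun_eq_iff)
    then show "wp N (Pop 4) Q (?s2(4 := 7 # rest, 14 := if ?s2 2 \<in> set us then [] else ?s2 14))"
      using Q by simp
    fix s :: stacks and Q assume "length (s 14) \<le> 1" "Q (s(14 := []))"
    then show "wp N (Pop 14) Q s" by (cases "s 14") auto
  qed (use assms in \<open>auto simp: is_bit_def\<close>)
  moreover have "?s1(4 := tl (?s1 4)) = ?s2" using assms(7) by (auto simp: fun_eq_iff)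
  ultimately show "wp N (Pop 4) (wp N (scan_words (Pop 14)) (wp N (Pop 4) Q)) ?s1" by simp
  fix s :: stacks and Q assume "length (s 14) \<le> 1" "Q (s(14 := [1]))"
  then show "wp N (Pop 14 ;; Push 14 1) Q s" using assms(8) by (cases "s 14") auto
qed (use assms in \<open>auto simp: is_bit_def\<close>)

text \<open>The accepted candidate travels through stack 5, since one \<open>move\<close> would
  reverse its digits.\<close>

definition commit :: com where
  "commit = Case 14 (\<lambda>e. if e = 0 then clear 10 ;; clear 11
     else Pop 14 ;; clear 8 ;; clear 9 ;; move 10 5 ;; move 5 8 ;; move 11 5 ;; move 5 9)"

lemma wp_commit:
  assumes s14: "s 14 = (if b then [1] else [])" and z: "bits (s 8)" "bits (s 9)" "bits (s 10)" "bits (s 11)"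
    and e: "s 5 = []" and N: "length (s 10) \<le> N" "length (s 11) \<le> N"
    and Q: "Q (s(8 := if b then s 10 else s 8, 9 := if b then s 11 else s 9, 10 := [], 11 := [], 14 := []))"
  shows "wp N commit Q s"
proof (cases b)
  case True
  have "wp N (clear 8 ;; clear 9 ;; move 10 5 ;; move 5 8 ;; move 11 5 ;; move 5 9) Q (s(14 := []))"
    unfolding wp_Seq
    apply (rule wp_clear)
    subgoal using z e by (auto dest: bits_zero_notin)
    apply (rule wp_clear)
    subgoal using z e by (auto dest: bits_zero_notin)
    apply (rule wp_move)
    subgoal by simp
    subgoal using z e by (auto dest: bits_zero_notin)
    subgoal using N e by simp
    apply (rule wp_move)
    subgoal by simp
    subgoal using z e by (auto dest: bits_zero_notin)
    subgoal using N e by simp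
    apply (rule wp_move)
    subgoal by simp
    subgoal using z e by (auto dest: bits_zero_notin)
    subgoal using N e by simp
    apply (rule wp_move)
    subgoal by simp
    subgoal using z e by (auto dest: bits_zero_notin)
    subgoal using N e by simp
    subgoal
      apply (rule iffD1[OF arg_cong[of _ _ Q] Q])
      using True e by (auto simp: fun_eq_iff)
    done
  then show ?thesis using s14 True by (simp add: commit_def)
next
  case False
  have "wp N (clear 10 ;; clear 11) Q s"
    unfolding wp_Seq
    apply (rule wp_clear)
    subgoal using z e by (auto dest: bits_zero_notin)
    apply (rule wp_clear)
    subgoal using z e by (auto dest: bits_zero_notin)
    subgoal
      apply (rule iffD1[OF arg_cong[of _ _ Q] Q])
      using False e s14 by (auto simp: fun_eq_iff)
    done
  then show ?thesis using s14 False by (simp add: commit_def)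
qed

definition read_term :: com where
  "read_term = read_coefficient ;; read_conditional ;; commit"

definition idle_stacks :: "stacks \<Rightarrow> bool" where
  "idle_stacks s \<longleftrightarrow> (\<forall>k\<in>{3, 5, 6, 7, 10, 11, 12, 13, 14}. s k = [])"

lemma wp_read_term:
  assumes s4: "s 4 = wa @ 3 # wb @ 6 # words_code vs @ 5 # words_code us @ 7 # rest"
    and w: "bits wa" "bits wb" "\<forall>w\<in>set vs. bits w \<and> w \<noteq> []" "\<forall>w\<in>set us. bits w \<and> w \<noteq> []"
    and b: "bits (s 2)" "bits (s 8)" "bits (s 9)" and e: "idle_stacks s"
    and N: "max (length (s 8)) (length (s 9)) + 2 * (length wa + length wb) < N" "length (s 2) \<le> N"
    and Q: "\<And>xs ys. bits xs \<Longrightarrow> bits ys \<Longrightarrow>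
      (bits_val xs, bits_val ys) = (if s 2 \<in> set vs - set us
         then (bits_val (rev wa) * bits_val (s 9) + bits_val (rev wb) * bits_val (s 8), bits_val (rev wb) * bits_val (s 9))
         else (bits_val (s 8), bits_val (s 9))) \<Longrightarrow>
      length xs \<le> max (length (s 8)) (length (s 9)) + 2 * (length wa + length wb) + 1 \<Longrightarrow>
      length ys \<le> max (length (s 8)) (length (s 9)) + 2 * (length wa + length wb) + 1 \<Longrightarrow>
      Q (s(4 := rest, 8 := xs, 9 := ys))"
  shows "wp N read_term Q s"
  unfolding read_term_def wp_Seq
proof (rule wp_read_coefficient[where wa = wa and wb = wb and
      rest = "words_code vs @ 5 # words_code us @ 7 # rest"])
  fix xs ys
  assume xy: "bits xs" "bits ys"
    "bits_val xs = bits_val (rev wa) * bits_val (s 9) + bits_val (rev wb) * bits_val (s 8)"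
    "bits_val ys = bits_val (rev wb) * bits_val (s 9)"
    "length xs \<le> max (length (s 8)) (length (s 9)) + 2 * (length wa + length wb) + 1"
    "length ys \<le> max (length (s 8)) (length (s 9)) + 2 * (length wa + length wb) + 1"
  let ?in = "s 2 \<in> set vs - set us"
  let ?s1 = "s(4 := words_code vs @ 5 # words_code us @ 7 # rest, 10 := xs, 11 := ys)"
  show "wp N read_conditional (wp N commit Q) ?s1"
  proof (rule wp_read_conditional)
    let ?s2 = "?s1(4 := rest, 14 := if ?s1 2 \<in> set vs - set us then [1] else [])"
    show "wp N commit Q ?s2"
    proof (rule wp_commit[where b = ?in])
      have "Q (s(4 := rest, 8 := if ?in then xs else s 8, 9 := if ?in then ys else s 9))"
        using xy b by (intro Q) auto
      moreover have "?s2(8 := if ?in then ?s2 10 else ?s2 8, 9 := if ?in then ?s2 11 else ?s2 9, 10 := [], 11 := [], 14 := [])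
          = s(4 := rest, 8 := if ?in then xs else s 8, 9 := if ?in then ys else s 9)"
        using e by (auto simp: fun_eq_iff idle_stacks_def)
      ultimately show "Q (?s2(8 := if ?in then ?s2 10 else ?s2 8, 9 := if ?in then ?s2 11 else ?s2 9,
          10 := [], 11 := [], 14 := []))"
        by (simp only:)
    qed (use xy b e N in \<open>auto simp: idle_stacks_def\<close>)
  qed (use w b e N in \<open>auto simp: idle_stacks_def\<close>)
qed (use s4 w b e N in \<open>auto simp: idle_stacks_def\<close>)

section \<open>The decision procedure\<close>

definition binary_code :: "nat \<Rightarrow> nat list" where
  "binary_code k = map letter_code (binary k)"

lemma binary_code_rec:
  "binary_code k = (if k < 2 then [] else binary_code (k div 2)) @ [if odd k then 2 else 1]"
  unfolding binary_code_def by (subst binary.simps) simp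

lemma binary_code_nonempty: "binary_code k \<noteq> []"
  by (subst binary_code_rec) simp

lemma bits_binary_code: "bits (binary_code k)"
proof (induction k rule: less_induct)
  case (less k)
  then show ?case by (subst binary_code_rec) simp
qed

lemma bits_val_binary_code: "bits_val (rev (binary_code k)) = k"
proof (induction k rule: less_induct)
  case (less k)
  show ?case
  proof (cases "k < 2")
    case True
    then have "k = 0 \<or> k = 1" by auto
    then show ?thesis by (subst binary_code_rec) auto
  next
    case False
    then have "bits_val (rev (binary_code (k div 2))) = k div 2" by (intro less.IH) auto
    then show ?thesis using False
      by (subst binary_code_rec) (auto simp: dig_def elim!: oddE)
  qed
qed

text \<open>This justifies comparing variables by comparing their words.\<close>

lemma inj_binary_code: "inj binary_code"
  by (rule inj_on_inverseI[where g = "\<lambda>w. bits_val (rev w)"]) (simp add: bits_val_binary_code)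

definition set_code :: "nat set \<Rightarrow> nat list" where
  "set_code V = words_code (map binary_code (sorted_list_of_set V))"

lemma map_encode_set: "map letter_code (encode_set V) = set_code V"
  by (simp add: encode_set_def set_code_def binary_code_def map_concat comp_def)

definition term_code :: "rat \<Rightarrow> nat conditional \<Rightarrow> nat list" where
  "term_code r = (\<lambda>(V, U). binary_code (nat (fst (quotient_of r))) @ 3 #
     binary_code (nat (snd (quotient_of r))) @ 6 # set_code V @ 5 # set_code U @ [7])"

lemma map_encode_term: "map letter_code (encode_term r \<sigma>) = term_code r \<sigma>"
  by (simp add: encode_term_def term_code_def encode_rat_def map_encode_set binary_code_def split: prod.splits)

lemma encode_instance_eq:
  "encode_instance (n, \<sigma>s, w) = set_code {..<n} @ 8 # concat (map (\<lambda>\<sigma>. term_code (w \<sigma>) \<sigma>) \<sigma>s)"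
  by (simp add: encode_instance_def map_encode_set map_concat comp_def map_encode_term)

lemma binary_code_in_sorted_list:
  "finite V \<Longrightarrow> binary_code i \<in> set (map binary_code (sorted_list_of_set V)) \<longleftrightarrow> i \<in> V"
  using inj_binary_code by (auto simp: inj_eq)

definition coverage :: "(nat conditional \<Rightarrow> rat) \<Rightarrow> nat conditional list \<Rightarrow> nat \<Rightarrow> rat" where
  "coverage w \<sigma>s i = (\<Sum>\<sigma>\<leftarrow>\<sigma>s. if i \<in> fst \<sigma> - snd \<sigma> then w \<sigma> else 0)"

definition scan_terms :: com where
  "scan_terms = While 4 nonblank read_term"

text \<open>The quantity \<open>max (length (s 8)) (length (s 9)) + 2 * length (s 4)\<close> is a
  potential: the growth of the fraction is paid for by the letters of the term consumed. A bound
  linear in the input thus suffices for any number of terms.\<close>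

lemma wp_scan_terms:
  assumes "s 4 = concat (map (\<lambda>\<sigma>. term_code (w \<sigma>) \<sigma>) \<sigma>s)"
    and "\<And>\<sigma>. \<sigma> \<in> set \<sigma>s \<Longrightarrow> 0 \<le> w \<sigma> \<and> finite (fst \<sigma>) \<and> finite (snd \<sigma>)"
    and "s 2 = binary_code i" "bits (s 8)" "bits (s 9)" "0 < bits_val (s 9)" "idle_stacks s"
    and "max (length (s 8)) (length (s 9)) + 2 * length (s 4) < N" "length (s 2) \<le> N"
    and "\<And>xs ys. bits xs \<Longrightarrow> bits ys \<Longrightarrow> 0 < bits_val ys \<Longrightarrow>
      of_nat (bits_val xs) / of_nat (bits_val ys) =
        of_nat (bits_val (s 8)) / of_nat (bits_val (s 9)) + coverage w \<sigma>s i \<Longrightarrow>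
      Q (s(4 := [], 8 := xs, 9 := ys))"
  shows "wp N scan_terms Q s"
  using assms
proof (induction \<sigma>s arbitrary: s)
  case Nil
  have eq: "s(4 := [], 8 := s 8, 9 := s 9) = s" using Nil.prems(1) by (auto simp: fun_eq_iff)
  have "Q (s(4 := [], 8 := s 8, 9 := s 9))"
    using Nil.prems by (intro Nil.prems(10)) (auto simp: coverage_def)
  then have "Q s" by (simp only: eq)
  then show ?case unfolding scan_terms_def using Nil.prems(1) by (intro wp_While_False) auto
next
  case (Cons \<sigma> \<sigma>s)
  obtain V U where \<sigma>: "\<sigma> = (V, U)" by fastforce
  obtain a b where ab: "quotient_of (w \<sigma>) = (a, b)" by fastforce
  have b: "0 < b" and r: "w \<sigma> = of_int a / of_int b"
    using quotient_of_denom_pos[OF ab] quotient_of_div[OF ab] by auto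
  have a: "0 \<le> a" using b r Cons.prems(2)[of \<sigma>] by (simp add: zero_le_divide_iff)
  define n m where "n = nat a" and "m = nat b"
  have m: "0 < m" and r': "w \<sigma> = of_nat n / of_nat m"
    using a b r by (simp_all add: n_def m_def)
  have fin: "finite V" "finite U" using Cons.prems(2)[of \<sigma>] \<sigma> by auto
  let ?rest = "concat (map (\<lambda>\<sigma>. term_code (w \<sigma>) \<sigma>) \<sigma>s)"
  let ?vs = "map binary_code (sorted_list_of_set V)" and ?us = "map binary_code (sorted_list_of_set U)"
  have s4: "s 4 = binary_code n @ 3 # binary_code m @ 6 # words_code ?vs @ 5 # words_code ?us @ 7 # ?rest"
    using Cons.prems(1) ab by (simp add: \<sigma> term_code_def set_code_def n_def m_def)
  \<comment> \<open>The 4 counts the separators of the term; doubled, they more than cover the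
    additional digit in the growth bound for one term.\<close>
  have len: "length (binary_code n) + length (binary_code m) + 4 + length ?rest \<le> length (s 4)"
    unfolding s4 by simp
  have "nonblank (top0 (s 4))"
    using bits_top0[OF bits_binary_code[of n]] binary_code_nonempty[of n] s4
    by (cases "binary_code n") auto
  then show ?case
    unfolding scan_terms_def
  proof (rule wp_While_True, fold scan_terms_def)
    show "wp N read_term (\<lambda>s'. length (s' 4) < length (s 4) \<and> wp N scan_terms Q s') s"
    proof (rule wp_read_term[where wa = "binary_code n" and wb = "binary_code m" and vs = ?vs and us = ?us
          and rest = ?rest])
      let ?mx = "max (length (s 8)) (length (s 9)) + 2 * (length (binary_code n) + length (binary_code m)) + 1"
      fix xs ys
      assume xy: "bits xs" "bits ys"
        "(bits_val xs, bits_val ys) = (if s 2 \<in> set ?vs - set ?us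
         then (bits_val (rev (binary_code n)) * bits_val (s 9) + bits_val (rev (binary_code m)) * bits_val (s 8),
               bits_val (rev (binary_code m)) * bits_val (s 9))
         else (bits_val (s 8), bits_val (s 9)))"
        "length xs \<le> ?mx" "length ys \<le> ?mx"
      have i: "s 2 \<in> set ?vs - set ?us \<longleftrightarrow> i \<in> V - U"
        using binary_code_in_sorted_list[OF fin(1)] binary_code_in_sorted_list[OF fin(2)] Cons.prems(3) by simp
      have v: "bits_val xs = (if i \<in> V - U then n * bits_val (s 9) + m * bits_val (s 8) else bits_val (s 8))"
        "bits_val ys = (if i \<in> V - U then m * bits_val (s 9) else bits_val (s 9))"
        using xy(3) unfolding i bits_val_binary_code by (auto split: if_splits)
      have pos: "0 < bits_val ys" using v(2) m Cons.prems(6) by simp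
      have q: "(of_nat (bits_val xs) / of_nat (bits_val ys) :: rat) =
          of_nat (bits_val (s 8)) / of_nat (bits_val (s 9)) + (if i \<in> V - U then w \<sigma> else 0)"
        using m Cons.prems(6) unfolding v r' by (auto simp: field_simps)
      let ?s = "s(4 := ?rest, 8 := xs, 9 := ys)"
      have "wp N scan_terms Q ?s"
      proof (rule Cons.IH)
        fix xs' ys'
        assume "bits xs'" "bits ys'" "0 < bits_val ys'"
          "of_nat (bits_val xs') / of_nat (bits_val ys') =
           of_nat (bits_val (?s 8)) / of_nat (bits_val (?s 9)) + coverage w \<sigma>s i"
        then have "Q (s(4 := [], 8 := xs', 9 := ys'))"
          using q by (intro Cons.prems(10)) (simp_all add: coverage_def \<sigma>)
        moreover have "?s(4 := [], 8 := xs', 9 := ys') = s(4 := [], 8 := xs', 9 := ys')"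
          by (auto simp: fun_eq_iff)
        ultimately show "Q (?s(4 := [], 8 := xs', 9 := ys'))" by (simp only:)
      next
        show "max (length (?s 8)) (length (?s 9)) + 2 * length (?s 4) < N"
          using Cons.prems(8) xy(4,5) len by auto
      qed (use Cons.prems xy pos in \<open>auto simp: idle_stacks_def\<close>)
      then show "length (?s 4) < length (s 4) \<and> wp N scan_terms Q ?s"
        using len by simp
    qed (use Cons.prems s4 len bits_binary_code binary_code_nonempty in auto)
  qed
qed

section \<open>Testing all variables\<close>

definition test_variable :: com where
  "test_variable = move_while is_bit 1 2 ;; move 0 5 ;; copy2 5 0 4 ;; Push 9 2 ;; scan_terms ;; compare ;; clear 2"

text \<open>The fraction starts as 0/1, with an empty numerator and \<open>[2]\<close> for the
  denominator; that one digit is the 1 in \<open>2 * length (s 0) + 1 < N\<close>. The word of the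
  variable lies reversed on stack 1 and is put right by moving it to stack 2.\<close>

lemma wp_test_variable:
  assumes s1: "s 1 = rev (binary_code i) @ rest" "\<not> is_bit (top0 rest)"
    and s0: "s 0 = concat (map (\<lambda>\<sigma>. term_code (w \<sigma>) \<sigma>) \<sigma>s)"
    and w: "\<And>\<sigma>. \<sigma> \<in> set \<sigma>s \<Longrightarrow> 0 \<le> w \<sigma> \<and> finite (fst \<sigma>) \<and> finite (snd \<sigma>)"
    and e: "s 2 = []" "s 4 = []" "s 8 = []" "s 9 = []" "idle_stacks s"
    and N: "2 * length (s 0) + 1 < N" "length (s 1) \<le> N"
    and Q: "Q (s(1 := rest, 15 := if 1 \<le> coverage w \<sigma>s i then s 15 else tl (s 15)))"
  shows "wp N test_variable Q s"
proof -
  let ?x = "binary_code i" and ?t = "s 0"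
  have e5: "s 5 = []" "s 7 = []" using e(5) by (simp_all add: idle_stacks_def)
  have tw: "takeWhile is_bit (s 1) = rev ?x" "dropWhile is_bit (s 1) = rest"
    using bits_binary_code[of i] s1 unfolding s1(1)
    by (auto simp: bits_def takeWhile_append dropWhile_append top0_def
        takeWhile_eq_Nil_iff dropWhile_eq_self_iff split: list.splits)
  have lx: "length ?x \<le> N" using N(2) s1(1) by simp
  have "0 \<notin> set (term_code r \<sigma>)" for r \<sigma>
    using bits_zero_notin[OF bits_binary_code]
    by (auto simp: term_code_def set_code_def split: prod.splits)
  then have z: "0 \<notin> set ?t" unfolding s0 by auto
  let ?s1 = "s(1 := rest, 2 := ?x)"
  let ?s3 = "s(1 := rest, 2 := ?x, 4 := ?t, 9 := [2])"
  have st: "wp N scan_terms (wp N compare (wp N (clear 2) Q)) ?s3"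
  proof (rule wp_scan_terms)
    fix xs ys
    assume xy: "bits xs" "bits ys" "0 < bits_val ys"
      "of_nat (bits_val xs) / of_nat (bits_val ys) =
       of_nat (bits_val (?s3 8)) / of_nat (bits_val (?s3 9)) + coverage w \<sigma>s i"
    let ?s4 = "?s3(4 := [], 8 := xs, 9 := ys)"
    have "coverage w \<sigma>s i = of_nat (bits_val xs) / of_nat (bits_val ys)"
      using xy(4) e by simp
    then have c: "bits_val xs < bits_val ys \<longleftrightarrow> \<not> 1 \<le> coverage w \<sigma>s i"
      using xy(3) by (auto simp: le_divide_eq)
    show "wp N compare (wp N (clear 2) Q) ?s4"
    proof (rule wp_compare)
      let ?s5 = "?s4(8 := [], 9 := [], 15 := if bits_val (?s4 8) < bits_val (?s4 9) then tl (?s4 15) else ?s4 15)"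
      have "?s5(2 := []) = s(1 := rest, 15 := if 1 \<le> coverage w \<sigma>s i then s 15 else tl (s 15))"
        using e c by (auto simp: fun_eq_iff)
      then have "Q (?s5(2 := []))" using Q by (simp only:)
      then show "wp N (clear 2) Q ?s5"
        using bits_zero_notin[OF bits_binary_code] by (intro wp_clear) auto
    qed (use xy e5 N in auto)
  qed (use e N s0 s1 w in \<open>auto simp: idle_stacks_def\<close>)
  show ?thesis
    unfolding test_variable_def wp_Seq
  proof (rule wp_move_while)
    let ?s2 = "s(1 := dropWhile is_bit (s 1), 2 := rev (takeWhile is_bit (s 1)) @ s 2)"
    have s2: "?s2 = ?s1" unfolding tw using e by simp
    let ?rest = "wp N (Push 9 2) (wp N scan_terms (wp N compare (wp N (clear 2) Q)))"
    have "wp N (move 0 5) (wp N (copy2 5 0 4) ?rest) ?s1"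
    proof (rule wp_move)
      let ?s6 = "?s1(0 := [], 5 := rev (?s1 0) @ ?s1 5)"
      show "wp N (copy2 5 0 4) ?rest ?s6"
      proof (rule wp_copy2)
        let ?s7 = "?s6(5 := [], 0 := rev (?s6 5) @ ?s6 0, 4 := rev (?s6 5) @ ?s6 4)"
        have "?s7(9 := [2]) = ?s3" "?s7 9 = []"
          using e e5 by (auto simp: fun_eq_iff)
        then show "?rest ?s7" using st N unfolding wp_Push by (simp only:) auto
      qed (use z e e5 N in auto)
    qed (use z e5 N in auto)
    then show "wp N (move 0 5) (wp N (copy2 5 0 4) ?rest) ?s2" unfolding s2 .
  qed (use e lx tw in auto)
qed

text \<open>The list of variables was reversed when it was moved to stack 1, so the comma that
  closed a word now stands in front of it and is popped first.\<close>

definition test_variables :: com where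
  "test_variables = While 1 nonblank (Pop 1 ;; test_variable)"

lemma wp_test_variables:
  assumes "s 1 = concat (map (\<lambda>i. 4 # rev (binary_code i)) js)"
    and s0: "s 0 = concat (map (\<lambda>\<sigma>. term_code (w \<sigma>) \<sigma>) \<sigma>s)"
    and w: "\<And>\<sigma>. \<sigma> \<in> set \<sigma>s \<Longrightarrow> 0 \<le> w \<sigma> \<and> finite (fst \<sigma>) \<and> finite (snd \<sigma>)"
    and "s 2 = []" "s 4 = []" "s 8 = []" "s 9 = []" "idle_stacks s" "length (s 15) \<le> 1"
    and "2 * length (s 0) + 1 < N" "length (s 1) \<le> N"
    and "Q (s(1 := [], 15 := if \<forall>i\<in>set js. 1 \<le> coverage w \<sigma>s i then s 15 else []))"
  shows "wp N test_variables Q s"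
  using assms(1,2,4-)
proof (induction js arbitrary: s)
  case Nil
  have eq: "s(1 := [], 15 := if \<forall>i\<in>set []. 1 \<le> coverage w \<sigma>s i then s 15 else []) = s"
    using Nil.prems(1) by (auto simp: fun_eq_iff)
  have "Q s" using Nil.prems(11) by (simp only: eq)
  then show ?case unfolding test_variables_def using Nil.prems(1) by (intro wp_While_False) auto
next
  case (Cons i js)
  let ?rest = "concat (map (\<lambda>i. 4 # rev (binary_code i)) js)"
  have s1: "s 1 = 4 # rev (binary_code i) @ ?rest" using Cons.prems(1) by simp
  have tl15: "tl (s 15) = []" using Cons.prems(8) by (cases "s 15") auto
  let ?c = "1 \<le> coverage w \<sigma>s i"
  let ?R = "\<lambda>s'. length (s' 1) < length (s 1) \<and> wp N test_variables Q s'"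
  have "nonblank (top0 (s 1))" using s1 by simp
  then show ?case
    unfolding test_variables_def
  proof (rule wp_While_True, fold test_variables_def)
    let ?s = "s(1 := rev (binary_code i) @ ?rest)"
    have "wp N test_variable ?R ?s"
    proof (rule wp_test_variable)
      let ?s' = "?s(1 := ?rest, 15 := if ?c then ?s 15 else tl (?s 15))"
      have "wp N test_variables Q ?s'"
      proof (rule Cons.IH)
        have "?s'(1 := [], 15 := if \<forall>i\<in>set js. 1 \<le> coverage w \<sigma>s i then ?s' 15 else []) =
            s(1 := [], 15 := if \<forall>i\<in>set (i # js). 1 \<le> coverage w \<sigma>s i then s 15 else [])"
          using tl15 by (auto simp: fun_eq_iff)
        then show "Q (?s'(1 := [], 15 := if \<forall>i\<in>set js. 1 \<le> coverage w \<sigma>s i then ?s' 15 else []))"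
          using Cons.prems(11) by (simp only:)
      qed (use Cons.prems tl15 in \<open>auto simp: idle_stacks_def\<close>)
      then show "?R ?s'" using s1 by simp
      show "\<not> is_bit (top0 ?rest)" by (cases js) (auto simp: is_bit_def)
    qed (use Cons.prems w in \<open>auto simp: idle_stacks_def\<close>)
    then show "wp N (Pop 1 ;; test_variable) ?R s" using s1 by simp
  qed
qed

text \<open>The variables are taken from the encoded left-hand side, so n never has to be counted.
  The answer is initially yes, and the separator with code 8 ends the variable list.\<close>

definition decide :: com where
  "decide = Push 15 1 ;; move_while (\<lambda>a. nonblank a \<and> a \<noteq> 8) 0 1 ;; Pop 0 ;; test_variables"

lemmas program_defs = decide_def test_variables_def test_variable_def scan_terms_def compare_def
  compare_step_def read_term_def commit_def read_conditional_def scan_words_def match_word_def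
  match_loop_def read_coefficient_def number_loop_def number_loop2_def

text \<open>Sixteen stacks, numbered from 0 to 15; nine symbols, namely the blank and the eight
  letters.\<close>

lemma wf_decide: "wf_com 16 9 decide"
  by (simp add: program_defs)

lemma wp_decide:
  assumes i: "(n, \<sigma>s, w) \<in> acyclic_instances" and N: "2 * length (encode_instance (n, \<sigma>s, w)) + 2 \<le> N"
  shows "wp N decide (\<lambda>s. top0 (s 15) \<noteq> 0 \<longleftrightarrow> (\<forall>i<n. 1 \<le> coverage w \<sigma>s i))
    (\<lambda>k. if k = 0 then encode_instance (n, \<sigma>s, w) else [])"
proof -
  have w: "0 \<le> w \<sigma> \<and> finite (fst \<sigma>) \<and> finite (snd \<sigma>)" if "\<sigma> \<in> set \<sigma>s" for \<sigma>
    using i that by (cases \<sigma>)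
      (auto simp: acyclic_instances_def acyclic_sigma_inequality_def sigma_inequality_def
        intro: finite_subset[of _ "{..<n}"])
  let ?t = "concat (map (\<lambda>\<sigma>. term_code (w \<sigma>) \<sigma>) \<sigma>s)" and ?v = "set_code {..<n}"
  let ?Q = "\<lambda>s. top0 (s 15) \<noteq> 0 \<longleftrightarrow> (\<forall>i<n. 1 \<le> coverage w \<sigma>s i)"
  define s :: stacks where "s = (\<lambda>k. if k = 0 then ?v @ 8 # ?t else [])"
  have "\<forall>a\<in>set ?v. nonblank a \<and> a \<noteq> 8"
    using bits_binary_code by (auto simp: set_code_def bits_def is_bit_def nonblank_def) fastforce+
  then have tw: "takeWhile (\<lambda>a. nonblank a \<and> a \<noteq> 8) (?v @ 8 # ?t) = ?v"
    "dropWhile (\<lambda>a. nonblank a \<and> a \<noteq> 8) (?v @ 8 # ?t) = 8 # ?t"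
    by (simp_all add: takeWhile_append dropWhile_append)
  have rv: "rev ?v = concat (map (\<lambda>i. 4 # rev (binary_code i)) (rev (sorted_list_of_set {..<n})))"
    by (simp add: set_code_def rev_concat rev_map comp_def)
  have lv: "length (concat (map (\<lambda>i. 4 # rev (binary_code i)) (rev (sorted_list_of_set {..<n})))) = length ?v"
    unfolding rv[symmetric] by simp
  let ?s = "s(15 := [Suc 0])"
  have "wp N (move_while (\<lambda>a. nonblank a \<and> a \<noteq> 8) 0 1) (wp N (Pop 0) (wp N test_variables ?Q)) ?s"
  proof (rule wp_move_while)
    let ?s1 = "?s(0 := ?t, 1 := rev ?v)"
    have "wp N test_variables ?Q ?s1"
      by (rule wp_test_variables[where w = w and \<sigma>s = \<sigma>s and js = "rev (sorted_list_of_set {..<n})"])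
        (use w N rv lv in \<open>auto simp: s_def idle_stacks_def encode_instance_eq\<close>)
    moreover have "(?s(0 := dropWhile (\<lambda>a. nonblank a \<and> a \<noteq> 8) (?s 0),
        1 := rev (takeWhile (\<lambda>a. nonblank a \<and> a \<noteq> 8) (?s 0)) @ ?s 1))(0 := ?t) = ?s1"
      by (auto simp: fun_eq_iff s_def tw)
    ultimately show "wp N (Pop 0) (wp N test_variables ?Q) (?s(0 := dropWhile (\<lambda>a. nonblank a \<and> a \<noteq> 8) (?s 0),
        1 := rev (takeWhile (\<lambda>a. nonblank a \<and> a \<noteq> 8) (?s 0)) @ ?s 1))"
      by (simp add: s_def tw)
  qed (use N in \<open>auto simp: s_def tw encode_instance_eq\<close>)
  then have "wp N decide ?Q s" unfolding decide_def wp_Seq using N by (simp add: s_def)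
  then show ?thesis unfolding s_def encode_instance_eq .
qed

lemma coverage_eq:
  assumes "distinct \<sigma>s"
  shows "(of_rat (coverage w \<sigma>s i) :: real) = (\<Sum>\<sigma> | \<sigma> \<in> set \<sigma>s \<and> i \<in> fst \<sigma> - snd \<sigma>. of_rat (w \<sigma>))"
proof -
  \<comment> \<open>The machine adds once per listed term, the inequality once per element of
    \<Sigma>; distinctness of the list identifies the two sums.\<close>
  have "coverage w \<sigma>s i = (\<Sum>\<sigma> | \<sigma> \<in> set \<sigma>s \<and> i \<in> fst \<sigma> - snd \<sigma>. w \<sigma>)"
    using assms by (simp add: coverage_def sum_list_distinct_conv_sum_set sum.inter_filter)
  then show ?thesis by (simp add: of_rat_sum)
qed

text \<open>The program \<open>decide\<close> does not mention \<open>K\<close>: by the covering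
  criterion, all families between the two extremes have the same valid acyclic inequalities, so one
  machine serves them all.\<close>

theorem proposition5:
  fixes K :: "nat \<Rightarrow> (nat set \<Rightarrow> real) set"
  assumes "\<And>n. n \<ge> 1 \<Longrightarrow> modular_polymatroids {..<n} \<subseteq> K n"
    and "\<And>n. n \<ge> 1 \<Longrightarrow> K n \<subseteq> polymatroids {..<n}"
  shows "polynomial_time_decidable encode_instance acyclic_instances (valid_instance K)"
proof (rule polynomial_time_decidableI[OF wf_decide])
  fix i :: sigma_instance assume "i \<in> acyclic_instances"
  moreover obtain n \<sigma>s w where i: "i = (n, \<sigma>s, w)" by (cases i)
  ultimately have I: "(n, \<sigma>s, w) \<in> acyclic_instances" by simp
  then have n: "1 \<le> n" "distinct \<sigma>s" "acyclic_sigma_inequality {..<n} (set \<sigma>s) (\<lambda>\<sigma>. of_rat (w \<sigma>))"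
    by (auto simp: acyclic_instances_def)
  have "valid_instance K i \<longleftrightarrow> (\<forall>j\<in>{..<n}. (1 :: real) \<le> of_rat (coverage w \<sigma>s j))"
    unfolding i valid_instance_def prod.case coverage_eq[OF n(2)]
    using n(1,3) assms by (intro valid_over_iff_cover) auto
  then have v: "valid_instance K i \<longleftrightarrow> (\<forall>j<n. 1 \<le> coverage w \<sigma>s j)" by auto
  \<comment> \<open>Twice the input length pays for the growth of the fraction, and the constant 2
    covers its initial denominator and the strictness of the height bound.\<close>
  let ?N = "poly [:2, 2:] (length (encode_instance i))"
  have "wp ?N decide (\<lambda>s. top0 (s 15) \<noteq> 0 \<longleftrightarrow> (\<forall>i<n. 1 \<le> coverage w \<sigma>s i))
    (\<lambda>k. if k = 0 then encode_instance i else [])"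
    unfolding i by (rule wp_decide[OF I]) simp
  then show "length (encode_instance i) \<le> ?N \<and>
      (\<exists>s. exec ?N decide (\<lambda>k. if k = 0 then encode_instance i else []) s \<and>
        (top0 (s 15) \<noteq> 0 \<longleftrightarrow> valid_instance K i))"
    unfolding v by (simp add: wp_def)
next
  have "letter_code x \<in> {1..<9}" for x by (cases x) auto
  then show "set (encode_instance i) \<subseteq> {1..<9}" for i
    by (auto simp: encode_instance_def split: prod.splits)
qed auto

end
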